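(* Let $A\in\mathbb{R}^{m\times n}$ ($m\ge n$) have simple singular values $\sigma_1>\sigma_2>\cdots>\sigma_n>0$ and let $b\in\mathbb{R}^m$. Assume that the problem $\min_x\|Ax-b\|$ is severely ill-posed with $\sigma_j=\mathcal{O}(\rho^{-j})$, $\rho>1$, $j=1,\dots,n$, and that the discrete Picard condition with parameter $\beta>0$ is satisfied (all in the sense described in the context). Let $\mathcal{V}_k=\mathrm{span}\{v_1,\dots,v_k\}$ and $\mathcal{V}_k^R=\mathcal{K}_k(A^TA,A^Tb)=\mathrm{span}\{A^Tb,(A^TA)A^Tb,\dots,(A^TA)^{k-1}A^Tb\}$. Then for $k=1,2,\dots,n-1$, $$\|\sin\Theta(\mathcal{V}_k,\mathcal{V}_k^R)\|=\frac{\|\Delta_k\|}{\sqrt{1+\|\Delta_k\|^2}},\qquad \|\tan\Theta(\mathcal{V}_k,\mathcal{V}_k^R)\|=\|\Delta_k\|,$$ where $\Delta_k\in\mathbb{R}^{(n-k)\times k}$ is the matrix defined in the context, and $$\|\Delta_1\|\le\frac{\sigma_2}{\sigma_1}\frac{|u_2^Tb|}{|u_1^Tb|}\left(1+\mathcal{O}(\rho^{-2})\right),$$ $$\|\Delta_k\|\le\frac{\sigma_{k+1}}{\sigma_k}\frac{|u_{k+1}^Tb|}{|u_k^Tb|}\left(1+\mathcal{O}(\rho^{-2})\right)|L_{k_1}^{(k)}(0)|,\quad k=2,3,\dots,n-1,$$ where $$|L_{k_1}^{(k)}(0)|=\max_{j=1,\dots,k}|L_j^{(k)}(0)|,\qquad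 |L_j^{(k)}(0)|=\prod_{i=1,\,i\ne j}^k\frac{\sigma_i^2}{|\sigma_j^2-\sigma_i^2|},\quad j=1,\dots,k.$$ In particular, $$\|\Delta_1\|\le\frac{\sigma_2^{2+\beta}}{\sigma_1^{2+\beta}}\left(1+\mathcal{O}(\rho^{-2})\right),$$ $$\|\Delta_k\|\le\frac{\sigma_{k+1}^{2+\beta}}{\sigma_k^{2+\beta}}\left(1+\mathcal{O}(\rho^{-2})\right)|L_{k_1}^{(k)}(0)|,\quad k=2,3,\dots,k_0,$$ $$\|\Delta_k\|\le\frac{\sigma_{k+1}}{\sigma_k}\left(1+\mathcal{O}(\rho^{-2})\right)|L_{k_1}^{(k)}(0)|,\quad k=k_0+1,\dots,n-1.$$
   Context: $\|\cdot\|$ is the 2-norm of a vector or matrix. The SVD of $A$ is $A=U\begin{pmatrix}\Sigma\\ \mathbf{0}\end{pmatrix}V^T$ with $U=(u_1,\dots,u_m)$ and $V=(v_1,\dots,v_n)$ orthogonal and $\Sigma=\mathrm{diag}(\sigma_1,\dots,\sigma_n)$. $\Theta(\mathcal{X},\mathcal{Y})$ denotes the canonical angles between two subspaces of equal dimension. Definition of $\Delta_k$ (all $u_i^Tb\neq0$): let $D=\mathrm{diag}(\sigma_iu_i^Tb)\in\mathbb{R}^{n\times n}$ and let $T_k\in\mathbb{R}^{n\times k}$ have $i$-th row $(1,\sigma_i^2,\sigma_i^4,\dots,\sigma_i^{2k-2})$. Partition $D=\mathrm{diag}(D_1,D_2)$ with $D_1\in\mathbb{R}^{k\times k}$ and $T_k=\begin{pmatrix}T_{k1}\\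 T_{k2}\end{pmatrix}$ with $T_{k1}\in\mathbb{R}^{k\times k}$ (a nonsingular Vandermonde matrix). Then $\Delta_k=D_2T_{k2}T_{k1}^{-1}D_1^{-1}$. Discrete Picard condition and noise model: $b=\hat b+e$ with $|u_i^T\hat b|=\sigma_i^{1+\beta}$, $i=1,\dots,n$, $\beta>0$, and $e$ white noise of level $\eta>0$, i.e. $|u_i^Te|\approx\eta$. The transition index $k_0$ is the index at which $|u_{k_0}^T b|\approx|u_{k_0}^T\hat b|>|u_{k_0}^Te|\approx\eta$ and $|u_{k_0+1}^Tb|\approx|u_{k_0+1}^Te|\approx\eta$. These relations are used in the following exact idealized form: $|u_j^Tb|=\sigma_j^{1+\beta}$ for $j\le k_0$; $|u_j^Tb|=\eta$ for $k_0<j\le n$; $|u_{j+1}^Tb|\le|u_j^Tb|$ for $1\le j\le n-1$; and $|u_{k+1}^Tb|/|u_k^Tb|=(\sigma_{k+1}/\sigma_k)^{1+\beta}$ for $k\le k_0$, $|u_{k+1}^Tb|/|u_k^Tb|=1$ for $k>k_0$. Severe ill-posedness: $\sigma_j=\mathcal{O}(\rho^{-j})$ is meant in the sense that the singular values decay at the geometric rate $\rho^{-1}$: there are constants $0<c\le C$ with $c\,\rho^{-(j-i)}\le\sigma_j/\sigma_i\le C\rho^{-(j-i)}$ for $1\le i\le j\le n$. The expression $1+\mathcal{O}(\rho^{-2})$ denotes a quantity $1+r$ with $|r|\le K\rho^{-2}$ for $\rho\ge\rho_0$, where $K$ and $\rho_0$ depend only on $c,C,\beta$ (not on $k$, $n$).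 *)

theory Defs
  imports
    Complex_Main
    "Jordan_Normal_Form.Gauss_Jordan_Elimination"
    "Jordan_Normal_Form.VS_Connect"
begin

text \<open>
  The constants in the error terms have to be uniform in the dimensions, so matrices and vectors
  with explicit carriers are used. Their entries are indexed from 0, whereas singular values
  \<open>\<sigma> i\<close>, singular vectors \<open>u\<^sub>i\<close>, \<open>v\<^sub>i\<close> and the index of regularization \<open>k\<close>
  are numbered from 1.
\<close>

definition vec_norm2 :: "real vec \<Rightarrow> real" where
  "vec_norm2 x = sqrt (x \<bullet> x)"

definition mat_norm2 :: "real mat \<Rightarrow> real" where
  "mat_norm2 A = (SUP x \<in> {x \<in> carrier_vec (dim_col A). vec_norm2 x \<le> 1}. vec_norm2 (A *\<^sub>v x))"

definition orthonormal_cols :: "real mat \<Rightarrow> bool" where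
  "orthonormal_cols Q \<longleftrightarrow> Q\<^sup>T * Q = 1\<^sub>m (dim_col Q)"

definition is_svd :: "nat \<Rightarrow> nat \<Rightarrow> real mat \<Rightarrow> real mat \<Rightarrow> real vec \<Rightarrow> real mat \<Rightarrow> bool" where
  "is_svd m n A U s V \<longleftrightarrow>
     n \<le> m \<and>
     U \<in> carrier_mat m m \<and> orthonormal_cols U \<and>
     V \<in> carrier_mat n n \<and> orthonormal_cols V \<and>
     s \<in> carrier_vec n \<and> (\<forall>i<n. 0 \<le> s $ i) \<and> (\<forall>i j. i \<le> j \<longrightarrow> j < n \<longrightarrow> s $ j \<le> s $ i) \<and>
     A = U * (mat_diag n (\<lambda>i. s $ i) @\<^sub>r 0\<^sub>m (m - n) n) * V\<^sup>T"

abbreviation sing_vec :: "real mat \<Rightarrow> nat \<Rightarrow> real vec" where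
  "sing_vec U i \<equiv> col U (i - 1)"

abbreviation vspan :: "nat \<Rightarrow> real vec set \<Rightarrow> real vec set" where
  "vspan n S \<equiv> LinearCombinations.module.span class_ring (module_vec TYPE(real) n) S"

definition krylov :: "nat \<Rightarrow> nat \<Rightarrow> real mat \<Rightarrow> real vec \<Rightarrow> real vec set" where
  "krylov n k M w = vspan n ((\<lambda>i. (M ^\<^sub>m i) *\<^sub>v w) ` {..<k})"

text \<open>
  The canonical angles between two \<open>k\<close>-dimensional subspaces of \<open>\<real>\<^sup>n\<close> (in increasing order):
  their cosines are the singular values of \<open>Q\<^sub>X\<^sup>T Q\<^sub>Y\<close> for orthonormal bases \<open>Q\<^sub>X\<close>, \<open>Q\<^sub>Y\<close>.
\<close>

definition is_canonical_angles ::
    "nat \<Rightarrow> nat \<Rightarrow> real vec set \<Rightarrow> real vec set \<Rightarrow> real vec \<Rightarrow> bool" where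
  "is_canonical_angles n k X Y \<theta> \<longleftrightarrow>
     \<theta> \<in> carrier_vec k \<and> (\<forall>i<k. 0 \<le> \<theta> $ i \<and> \<theta> $ i \<le> pi / 2) \<and>
     (\<exists>QX \<in> carrier_mat n k. \<exists>QY \<in> carrier_mat n k.
        orthonormal_cols QX \<and> vspan n (set (cols QX)) = X \<and>
        orthonormal_cols QY \<and> vspan n (set (cols QY)) = Y \<and>
        (\<exists>P W. is_svd k k (QX\<^sup>T * QY) P (map_vec cos \<theta>) W))"

definition canonical_angles :: "nat \<Rightarrow> nat \<Rightarrow> real vec set \<Rightarrow> real vec set \<Rightarrow> real vec" where
  "canonical_angles n k X Y = (SOME \<theta>. is_canonical_angles n k X Y \<theta>)"

text \<open>
  \<open>f \<Theta>\<close> for the diagonal matrix \<open>\<Theta>\<close> of canonical angles and \<open>f = sin\<close>, \<open>f = tan\<close>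
  acting on the diagonal.
\<close>

definition fun_Theta ::
    "(real \<Rightarrow> real) \<Rightarrow> nat \<Rightarrow> nat \<Rightarrow> real vec set \<Rightarrow> real vec set \<Rightarrow> real mat" where
  "fun_Theta f n k X Y = mat_diag k (\<lambda>i. f (canonical_angles n k X Y $ i))"

text \<open>In the following, \<open>\<gamma> i\<close> stands for \<open>u\<^sub>i\<^sup>T b\<close>.\<close>

definition D_mat :: "nat \<Rightarrow> (nat \<Rightarrow> real) \<Rightarrow> (nat \<Rightarrow> real) \<Rightarrow> real mat" where
  "D_mat n \<sigma> \<gamma> = mat_diag n (\<lambda>i. \<sigma> (Suc i) * \<gamma> (Suc i))"

definition T_mat :: "nat \<Rightarrow> nat \<Rightarrow> (nat \<Rightarrow> real) \<Rightarrow> real mat" where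
  "T_mat n k \<sigma> = mat n k (\<lambda>(i, j). \<sigma> (Suc i) ^ (2 * j))"

text \<open>The blocks of \<open>T_mat\<close> ignored below have no columns.\<close>

definition Delta_mat :: "nat \<Rightarrow> nat \<Rightarrow> (nat \<Rightarrow> real) \<Rightarrow> (nat \<Rightarrow> real) \<Rightarrow> real mat" where
  "Delta_mat n k \<sigma> \<gamma> =
     (let (D1, _, _, D2) = split_block (D_mat n \<sigma> \<gamma>) k k;
          (T1, _, T2, _) = split_block (T_mat n k \<sigma>) k k
      in D2 * T2 * the (mat_inverse T1) * the (mat_inverse D1))"

definition abs_L0 :: "nat \<Rightarrow> (nat \<Rightarrow> real) \<Rightarrow> nat \<Rightarrow> real" where
  "abs_L0 k \<sigma> j = (\<Prod>i \<in> {1..k} - {j}. (\<sigma> i)\<^sup>2 / \<bar>(\<sigma> j)\<^sup>2 - (\<sigma> i)\<^sup>2\<bar>)"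

definition max_abs_L0 :: "nat \<Rightarrow> (nat \<Rightarrow> real) \<Rightarrow> real" where
  "max_abs_L0 k \<sigma> = Max (abs_L0 k \<sigma> ` {1..k})"

definition severely_ill_posed :: "real \<Rightarrow> real \<Rightarrow> real \<Rightarrow> nat \<Rightarrow> (nat \<Rightarrow> real) \<Rightarrow> bool" where
  "severely_ill_posed c C \<rho> n \<sigma> \<longleftrightarrow>
     \<rho> > 1 \<and>
     (\<forall>i j. 1 \<le> i \<longrightarrow> i \<le> j \<longrightarrow> j \<le> n \<longrightarrow>
        c / \<rho> ^ (j - i) \<le> \<sigma> j / \<sigma> i \<and> \<sigma> j / \<sigma> i \<le> C / \<rho> ^ (j - i))"

text \<open>
  The discrete Picard condition for the exact part \<open>bh\<close> of \<open>b = bh + e\<close>, and the idealized form of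
  the noise model with transition index \<open>k0\<close>. The approximate relations for the noise \<open>e\<close> enter
  only through their exact consequences for \<open>b\<close>; requiring both
  \<open>\<bar>u\<^sub>i\<^sup>T e\<bar> = \<eta>\<close> and these consequences would be contradictory.
\<close>

definition discrete_picard ::
    "nat \<Rightarrow> nat \<Rightarrow> real mat \<Rightarrow> (nat \<Rightarrow> real) \<Rightarrow> real \<Rightarrow> real vec \<Rightarrow> real vec \<Rightarrow> real vec \<Rightarrow> real \<Rightarrow> nat \<Rightarrow> bool"
  where
  "discrete_picard m n U \<sigma> \<beta> b bh e \<eta> k0 \<longleftrightarrow>
     bh \<in> carrier_vec m \<and> e \<in> carrier_vec m \<and> b = bh + e \<and>
     (\<forall>i \<in> {1..n}. \<bar>sing_vec U i \<bullet> bh\<bar> = \<sigma> i powr (1 + \<beta>)) \<and>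
     0 < \<eta> \<and> 1 \<le> k0 \<and> k0 < n \<and>
     (\<forall>j \<in> {1..k0}. \<bar>sing_vec U j \<bullet> b\<bar> = \<sigma> j powr (1 + \<beta>)) \<and>
     (\<forall>j \<in> {k0<..n}. \<bar>sing_vec U j \<bullet> b\<bar> = \<eta>) \<and>
     (\<forall>j \<in> {1..<n}. \<bar>sing_vec U (j + 1) \<bullet> b\<bar> \<le> \<bar>sing_vec U j \<bullet> b\<bar>) \<and>
     (\<forall>k \<in> {1..k0}. \<bar>sing_vec U (k + 1) \<bullet> b\<bar> / \<bar>sing_vec U k \<bullet> b\<bar>
                        = (\<sigma> (k + 1) / \<sigma> k) powr (1 + \<beta>)) \<and>
     (\<forall>k \<in> {k0<..<n}. \<bar>sing_vec U (k + 1) \<bullet> b\<bar> / \<bar>sing_vec U k \<bullet> b\<bar> = 1)"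

end

theory Submission
  imports Defs "Jordan_Normal_Form.Schur_Decomposition" "HOL-Analysis.L2_Norm"
begin

text \<open>
In the orthonormal basis of right singular vectors, \<open>(A\<^sup>T A)\<^sup>j A\<^sup>T b\<close> becomes column \<open>j\<close> of the matrix
\<open>D T\<^sub>k\<close>. Its upper \<open>k\<close> rows \<open>D\<^sub>1 T\<^sub>k\<^sub>1\<close> form an invertible matrix. Multiplying by the inverse from
the right does not change the column span and turns \<open>D T\<^sub>k\<close> into the identity stacked on \<open>\<Delta>\<^sub>k\<close>
(\<open>D_T_factorization\<close>). So the Krylov space is the graph of \<open>\<Delta>\<^sub>k\<close> over the span of
\<open>v\<^sub>1, \<dots>, v\<^sub>k\<close>, and the tangents of the canonical angles between a subspace and a graph over it are the
singular values of the graph map. The latter is proved by diagonalizing \<open>\<Delta>\<^sub>k\<^sup>T \<Delta>\<^sub>k\<close>: the diagonalization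
provides canonical angles, and conversely every choice of canonical angles leads to such a
diagonalization (\<open>canonical_angles_of_graph_exist\<close>, \<open>tan_canonical_angles_of_graph\<close>).
The formulas for the norms of sine and tangent follow by looking at the largest angle. The spectral
theorem for real symmetric matrices that this requires is derived from the splitting of complex
characteristic polynomials.

For the estimates, inverting the Vandermonde matrix by Lagrange interpolation shows that the entries
of \<open>\<Delta>\<^sub>k\<close> are
\<open>\<sigma>\<^sub>j \<gamma>\<^sub>j L\<^sub>i(\<sigma>\<^sub>j\<^sup>2) / (\<sigma>\<^sub>i \<gamma>\<^sub>i)\<close> for \<open>i \<le> k < j\<close> and \<open>\<gamma>\<^sub>i = u\<^sub>i\<^sup>T b\<close>. Since \<open>\<sigma>\<^sub>j\<^sup>2\<close> lies between 0 and all nodes,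
\<open>\<bar>L\<^sub>i(\<sigma>\<^sub>j\<^sup>2)\<bar> \<le> \<bar>L\<^sub>i(0)\<bar>\<close>. Thus \<open>\<Delta>\<^sub>k\<close> is dominated entrywise by \<open>max\<^sub>i \<bar>L\<^sub>i(0)\<bar>\<close> times the rank-one matrix
with entries \<open>\<sigma>\<^sub>j \<bar>\<gamma>\<^sub>j\<bar> / (\<sigma>\<^sub>i \<bar>\<gamma>\<^sub>i\<bar>)\<close>. The numbers \<open>\<sigma>\<^sub>j \<bar>\<gamma>\<^sub>j\<bar>\<close> decay at least geometrically with
ratio \<open>1 / \<rho>\<close>, up to the factor \<open>C\<close>. Therefore the norms of both factors of this matrix agree with those of
their dominant entries, the ones at \<open>j = k + 1\<close> and \<open>i = k\<close>, up to a factor \<open>1 + O(1 / \<rho>\<^sup>2)\<close>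
that depends only on \<open>C\<close> (\<open>norm_Delta_mat_le\<close>).
\<close>

section \<open>The spectral norm and column spaces\<close>

lemma assoc_mult_mat_dim:
  fixes A B C :: "'a :: comm_semiring_0 mat"
  assumes "dim_col A = dim_row B" "dim_col B = dim_row C"
  shows "A * B * C = A * (B * C)"
  using assms by (intro assoc_mult_mat[of A "dim_row A" _ B "dim_row C" C "dim_col C"]) auto

lemma transpose_mult_dim:
  fixes A B :: "'a :: comm_semiring_0 mat"
  assumes "dim_col A = dim_row B"
  shows "(A * B)\<^sup>T = B\<^sup>T * A\<^sup>T"
  using assms by (intro transpose_mult[of A "dim_row A" "dim_row B" B "dim_col B"]) auto

lemma vec_norm2_nonneg [simp]: "0 \<le> vec_norm2 x"
  by (simp add: vec_norm2_def scalar_prod_def sum_nonneg)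

lemma vec_norm2_L2_set: "vec_norm2 x = L2_set (\<lambda>i. x $ i) {0..<dim_vec x}"
  by (simp add: vec_norm2_def scalar_prod_def L2_set_def power2_eq_square)

lemma orthonormal_cols_square:
  assumes "Q \<in> carrier_mat k k" "orthonormal_cols Q"
  shows "Q\<^sup>T * Q = 1\<^sub>m k" "Q * Q\<^sup>T = 1\<^sub>m k"
proof -
  show 1: "Q\<^sup>T * Q = 1\<^sub>m k" using assms by (auto simp: orthonormal_cols_def)
  show "Q * Q\<^sup>T = 1\<^sub>m k"
    by (rule mat_mult_left_right_inverse[OF _ _ 1]) (use assms in auto)
qed

lemma scalar_prod_gram:
  fixes A :: "'a :: comm_semiring_0 mat"
  assumes "A \<in> carrier_mat n k" "x \<in> carrier_vec k" "y \<in> carrier_vec k"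
  shows "(A *\<^sub>v x) \<bullet> (A *\<^sub>v y) = x \<bullet> ((A\<^sup>T * A) *\<^sub>v y)"
proof -
  have "(A *\<^sub>v x) \<bullet> (A *\<^sub>v y) = (A\<^sup>T *\<^sub>v (A *\<^sub>v y)) \<bullet> x"
    using assms transpose_vec_mult_scalar[of A n k x "A *\<^sub>v y"]
    by (metis comm_scalar_prod mult_mat_vec_carrier)
  also have "\<dots> = x \<bullet> (A\<^sup>T *\<^sub>v (A *\<^sub>v y))"
    using assms by (intro comm_scalar_prod[of _ k]) auto
  also have "A\<^sup>T *\<^sub>v (A *\<^sub>v y) = (A\<^sup>T * A) *\<^sub>v y"
    using assms by (intro assoc_mult_mat_vec[symmetric, of _ k n]) auto
  finally show ?thesis .
qed

lemma vec_norm2_orthonormal_mult: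
  assumes "Q \<in> carrier_mat n k" "Q\<^sup>T * Q = 1\<^sub>m k" "x \<in> carrier_vec k"
  shows "vec_norm2 (Q *\<^sub>v x) = vec_norm2 x"
  using scalar_prod_gram[of Q n k x x] assms by (simp add: vec_norm2_def)

text \<open>
The norm of a matrix depends only on its Gram matrix, up to an orthogonal change of coordinates.
This transfers the norm of \<open>\<Delta>\<^sub>k\<close> to the diagonal matrix of tangents, whose size is different. No
attained maximum is needed: the two suprema range over the same set of values.
\<close>

lemma mat_norm2_eq_if_gram_eq:
  assumes A: "A \<in> carrier_mat p k" and B: "B \<in> carrier_mat q k"
    and S: "S \<in> carrier_mat k k" "S\<^sup>T * S = 1\<^sub>m k"
    and gram: "S\<^sup>T * (A\<^sup>T * A) * S = B\<^sup>T * B"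
  shows "mat_norm2 A = mat_norm2 B"
proof -
  have S': "S * S\<^sup>T = 1\<^sub>m k"
    using mat_mult_left_right_inverse[OF _ _ S(2)] S(1) by auto
  have STST: "(S\<^sup>T)\<^sup>T * S\<^sup>T = 1\<^sub>m k" using S' by simp
  have norm: "vec_norm2 (A *\<^sub>v (S *\<^sub>v y)) = vec_norm2 (B *\<^sub>v y)" if y: "y \<in> carrier_vec k" for y
  proof -
    have AS: "A * S \<in> carrier_mat p k" using A S by auto
    have "(A * S)\<^sup>T * (A * S) = B\<^sup>T * B"
    proof -
      have "(A * S)\<^sup>T = S\<^sup>T * A\<^sup>T" by (rule transpose_mult[OF A S(1)])
      then have "(A * S)\<^sup>T * (A * S) = S\<^sup>T * (A\<^sup>T * A) * S"
        using A S by (simp add: assoc_mult_mat_dim)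
      then show ?thesis using gram by simp
    qed
    then have "((A * S) *\<^sub>v y) \<bullet> ((A * S) *\<^sub>v y) = (B *\<^sub>v y) \<bullet> (B *\<^sub>v y)"
      using scalar_prod_gram[OF AS y y] scalar_prod_gram[OF B y y] by simp
    then show ?thesis using A S y by (simp add: vec_norm2_def)
  qed
  let ?U = "{x \<in> carrier_vec k. vec_norm2 x \<le> 1}"
  have "(\<lambda>x. vec_norm2 (A *\<^sub>v x)) ` ?U = (\<lambda>x. vec_norm2 (B *\<^sub>v x)) ` ?U"
  proof (intro equalityI subsetI; elim imageE)
    fix z x assume z: "z = vec_norm2 (A *\<^sub>v x)" and x: "x \<in> ?U"
    let ?y = "S\<^sup>T *\<^sub>v x"
    have xc: "x \<in> carrier_vec k" using x by auto
    have y: "?y \<in> carrier_vec k" using xc S by auto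
    have "S *\<^sub>v ?y = (S * S\<^sup>T) *\<^sub>v x" using S xc by (intro assoc_mult_mat_vec[symmetric]) auto
    then have "S *\<^sub>v ?y = x" using S' xc by simp
    moreover have "vec_norm2 ?y = vec_norm2 x"
      using vec_norm2_orthonormal_mult[OF _ STST xc] S by auto
    ultimately show "z \<in> (\<lambda>x. vec_norm2 (B *\<^sub>v x)) ` ?U"
      using norm[OF y] x z y by auto
  next
    fix z y assume z: "z = vec_norm2 (B *\<^sub>v y)" and y: "y \<in> ?U"
    have "vec_norm2 (S *\<^sub>v y) = vec_norm2 y"
      using vec_norm2_orthonormal_mult[OF S] y by auto
    moreover have "S *\<^sub>v y \<in> carrier_vec k" using S y by auto
    ultimately show "z \<in> (\<lambda>x. vec_norm2 (A *\<^sub>v x)) ` ?U"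
      using norm[of y] z y by (intro image_eqI[of _ _ "S *\<^sub>v y"]) auto
  qed
  then show ?thesis using A B by (simp add: mat_norm2_def)
qed

lemma mat_norm2_leI:
  assumes A: "A \<in> carrier_mat p k"
    and bound: "\<And>x. x \<in> carrier_vec k \<Longrightarrow> vec_norm2 x \<le> 1 \<Longrightarrow> vec_norm2 (A *\<^sub>v x) \<le> N"
  shows "mat_norm2 A \<le> N"
  unfolding mat_norm2_def
proof (rule cSUP_least)
  have "vec_norm2 (0\<^sub>v k) \<le> 1" by (simp add: vec_norm2_def)
  then show "{x \<in> carrier_vec (dim_col A). vec_norm2 x \<le> 1} \<noteq> {}"
    using A zero_carrier_vec[of k] by blast
qed (use A bound in auto)

text \<open>
The bound \<open>N\<close> only certifies that the supremum defining the norm is finite.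
\<close>

lemma vec_norm2_mult_le_mat_norm2:
  assumes A: "A \<in> carrier_mat p k"
    and bound: "\<And>x. x \<in> carrier_vec k \<Longrightarrow> vec_norm2 x \<le> 1 \<Longrightarrow> vec_norm2 (A *\<^sub>v x) \<le> N"
    and x: "x \<in> carrier_vec k" "vec_norm2 x \<le> 1"
  shows "vec_norm2 (A *\<^sub>v x) \<le> mat_norm2 A"
  unfolding mat_norm2_def
proof (rule cSUP_upper)
  show "bdd_above ((\<lambda>x. vec_norm2 (A *\<^sub>v x)) ` {x \<in> carrier_vec (dim_col A). vec_norm2 x \<le> 1})"
    using A bound by (auto intro!: bdd_aboveI[of _ N])
qed (use A x in auto)

lemma mat_diag_mult_vec:
  fixes d :: "nat \<Rightarrow> 'a :: comm_semiring_0"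
  assumes "x \<in> carrier_vec k"
  shows "mat_diag k d *\<^sub>v x = vec k (\<lambda>i. d i * x $ i)"
proof (rule eq_vecI)
  fix i assume "i < dim_vec (vec k (\<lambda>i. d i * x $ i))"
  then have i: "i < k" by simp
  have "(mat_diag k d *\<^sub>v x) $ i = (\<Sum>j\<in>{0..<k}. (if i = j then d j else 0) * x $ j)"
    using i assms by (simp add: scalar_prod_def mat_diag_def)
  also have "\<dots> = (\<Sum>j\<in>{0..<k}. (if i = j then d j * x $ j else 0))"
    by (intro sum.cong) auto
  finally show "(mat_diag k d *\<^sub>v x) $ i = vec k (\<lambda>i. d i * x $ i) $ i"
    using i by simp
qed (simp add: mat_diag_def)

lemma mat_norm2_diag:
  assumes j: "j < k" and max: "\<And>i. i < k \<Longrightarrow> \<bar>d i\<bar> \<le> \<bar>d j\<bar>"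
  shows "mat_norm2 (mat_diag k d) = \<bar>d j\<bar>"
proof -
  have bound: "vec_norm2 (mat_diag k d *\<^sub>v x) \<le> \<bar>d j\<bar>"
    if x: "x \<in> carrier_vec k" "vec_norm2 x \<le> 1" for x
  proof -
    have "vec_norm2 (mat_diag k d *\<^sub>v x) = L2_set (\<lambda>i. d i * x $ i) {0..<k}"
      using x by (simp add: vec_norm2_L2_set mat_diag_mult_vec cong: L2_set_cong_simp)
    also have "\<dots> = L2_set (\<lambda>i. \<bar>d i * x $ i\<bar>) {0..<k}"
      by (simp add: L2_set_def)
    also have "\<dots> \<le> L2_set (\<lambda>i. \<bar>d j\<bar> * \<bar>x $ i\<bar>) {0..<k}"
      by (rule L2_set_mono) (auto simp: abs_mult intro!: mult_right_mono max)
    also have "\<dots> = \<bar>d j\<bar> * L2_set (\<lambda>i. \<bar>x $ i\<bar>) {0..<k}"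
      by (simp add: L2_set_right_distrib)
    also have "L2_set (\<lambda>i. \<bar>x $ i\<bar>) {0..<k} = vec_norm2 x"
      using x by (simp add: vec_norm2_L2_set L2_set_def)
    also have "\<bar>d j\<bar> * vec_norm2 x \<le> \<bar>d j\<bar> * 1"
      using x by (intro mult_left_mono) auto
    finally show ?thesis by simp
  qed
  have e: "unit_vec k j \<in> carrier_vec k" "vec_norm2 (unit_vec k j) \<le> 1"
    using j by (auto simp: vec_norm2_def)
  have "mat_diag k d *\<^sub>v unit_vec k j = d j \<cdot>\<^sub>v unit_vec k j"
    by (subst mat_diag_mult_vec) (auto simp: unit_vec_def)
  then have "vec_norm2 (mat_diag k d *\<^sub>v unit_vec k j) = \<bar>d j\<bar>"
    using j by (simp add: vec_norm2_def)
  moreover have "vec_norm2 (mat_diag k d *\<^sub>v unit_vec k j) \<le> mat_norm2 (mat_diag k d)"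
    by (rule vec_norm2_mult_le_mat_norm2[OF mat_diag_dim bound e])
  moreover have "mat_norm2 (mat_diag k d) \<le> \<bar>d j\<bar>"
    by (rule mat_norm2_leI[OF mat_diag_dim bound])
  ultimately show ?thesis by simp
qed

text \<open>
Entries dominated by those of a rank-one matrix \<open>f g\<^sup>T\<close> give the norm of that matrix as a bound,
by the Cauchy-Schwarz inequality in each row.
\<close>

lemma mat_norm2_le_of_entries:
  assumes A: "A \<in> carrier_mat p k"
    and entries: "\<And>i j. i < p \<Longrightarrow> j < k \<Longrightarrow> \<bar>A $$ (i, j)\<bar> \<le> f i * g j"
    and f: "\<And>i. i < p \<Longrightarrow> 0 \<le> f i"
  shows "mat_norm2 A \<le> L2_set f {0..<p} * L2_set g {0..<k}"
proof (rule mat_norm2_leI[OF A])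
  fix x :: "real vec" assume x: "x \<in> carrier_vec k" "vec_norm2 x \<le> 1"
  have row: "\<bar>(A *\<^sub>v x) $ i\<bar> \<le> L2_set g {0..<k} * f i" if i: "i < p" for i
  proof -
    have "\<bar>(A *\<^sub>v x) $ i\<bar> = \<bar>\<Sum>j\<in>{0..<k}. A $$ (i, j) * x $ j\<bar>"
      using A x i by (simp add: scalar_prod_def)
    also have "\<dots> \<le> (\<Sum>j\<in>{0..<k}. \<bar>A $$ (i, j)\<bar> * \<bar>x $ j\<bar>)"
      by (rule order_trans[OF sum_abs]) (simp add: abs_mult)
    also have "\<dots> \<le> (\<Sum>j\<in>{0..<k}. f i * (\<bar>g j\<bar> * \<bar>x $ j\<bar>))"
    proof (rule sum_mono)
      fix j assume "j \<in> {0..<k}"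
      then have "\<bar>A $$ (i, j)\<bar> \<le> f i * g j" using entries i by auto
      also have "\<dots> \<le> f i * \<bar>g j\<bar>" using f[OF i] by (intro mult_left_mono) auto
      finally show "\<bar>A $$ (i, j)\<bar> * \<bar>x $ j\<bar> \<le> f i * (\<bar>g j\<bar> * \<bar>x $ j\<bar>)"
        by (metis abs_ge_zero mult.assoc mult_right_mono)
    qed
    also have "\<dots> = f i * (\<Sum>j\<in>{0..<k}. \<bar>g j\<bar> * \<bar>x $ j\<bar>)" by (simp add: sum_distrib_left)
    also have "\<dots> \<le> f i * (L2_set g {0..<k} * L2_set (\<lambda>j. x $ j) {0..<k})"
      using f[OF i] by (intro mult_left_mono L2_set_mult_ineq) auto
    also have "\<dots> \<le> f i * (L2_set g {0..<k} * 1)"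
      using f[OF i] x by (intro mult_left_mono) (auto simp: vec_norm2_L2_set)
    finally show ?thesis by (simp add: mult.commute)
  qed
  have "vec_norm2 (A *\<^sub>v x) = L2_set (\<lambda>i. \<bar>(A *\<^sub>v x) $ i\<bar>) {0..<p}"
    using A by (simp add: vec_norm2_L2_set L2_set_def)
  also have "\<dots> \<le> L2_set (\<lambda>i. L2_set g {0..<k} * f i) {0..<p}"
    using row by (intro L2_set_mono) auto
  also have "\<dots> = L2_set f {0..<p} * L2_set g {0..<k}"
    by (subst L2_set_right_distrib[symmetric]) auto
  finally show "vec_norm2 (A *\<^sub>v x) \<le> L2_set f {0..<p} * L2_set g {0..<k}" .
qed

lemma vspan_cols:
  assumes "M \<in> carrier_mat n k"
  shows "vspan n (set (cols M)) = (\<lambda>w. M *\<^sub>v w) ` carrier_vec k"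
proof -
  interpret vec_space "TYPE(real)" n .
  show ?thesis
    using col_space_eq[OF assms] assms unfolding col_space_def by auto
qed

lemma vspan_cols_subset_factor:
  assumes M: "M \<in> carrier_mat n k" and N: "N \<in> carrier_mat n l"
    and sub: "vspan n (set (cols N)) \<subseteq> vspan n (set (cols M))"
  shows "\<exists>R \<in> carrier_mat k l. N = M * R"
proof -
  have "\<exists>w \<in> carrier_vec k. col N j = M *\<^sub>v w" if j: "j < l" for j
  proof -
    have "N *\<^sub>v unit_vec l j \<in> vspan n (set (cols N))"
      unfolding vspan_cols[OF N] by auto
    moreover have "N *\<^sub>v unit_vec l j = col N j"
      using N j by (intro eq_vecI) auto
    ultimately show ?thesis using sub unfolding vspan_cols[OF M] by auto
  qed
  then obtain w where w: "\<And>j. j < l \<Longrightarrow> w j \<in> carrier_vec k \<and> col N j = M *\<^sub>v w j"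
    by metis
  define R where "R = mat_of_cols k (map w [0..<l])"
  have R: "R \<in> carrier_mat k l" by (auto simp: R_def mat_of_cols_def)
  have "N = M * R"
  proof (rule mat_col_eqI)
    fix j assume "j < dim_col (M * R)"
    then have j: "j < l" using R by auto
    have "col (M * R) j = M *\<^sub>v col R j" using M R j by (intro col_mult2) auto
    also have "col R j = w j" using j w by (simp add: R_def)
    finally show "col N j = col (M * R) j" using w j by simp
  qed (use M N R in auto)
  then show ?thesis using R by blast
qed

section \<open>Diagonalization of real symmetric matrices\<close>

lemma conjugate_vec_real [simp]: "conjugate (v :: real vec) = v"
  by (intro eq_vecI) auto

text \<open>
Over \<open>\<complex>\<close> the characteristic polynomial splits. Each root \<open>a\<close> is real, since for an
eigenvector \<open>v\<close> the number \<open>v\<^sup>* A v\<close> equals both \<open>a \<parallel>v\<parallel>\<^sup>2\<close> and, by symmetry, its own conjugate.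
\<close>

lemma real_symmetric_char_poly_splits:
  fixes A :: "real mat"
  assumes A: "A \<in> carrier_mat n n" and sym: "A\<^sup>T = A"
  shows "\<exists>es. char_poly A = (\<Prod>e\<leftarrow>es. [:- e, 1:])"
proof -
  define B where "B = map_mat complex_of_real A"
  have B: "B \<in> carrier_mat n n" and symB: "B\<^sup>T = B"
    using A sym by (auto simp: B_def map_mat_transpose)
  obtain as where as: "char_poly B = (\<Prod>a\<leftarrow>as. [:- a, 1:])"
    using char_poly_factorized[OF B] by auto
  have conj: "B *\<^sub>v conjugate w = conjugate (B *\<^sub>v w)" if "w \<in> carrier_vec n" for w
    using that A by (intro eq_vecI) (auto simp: B_def scalar_prod_def)
  have real: "a \<in> \<real>" if "a \<in> set as" for a
  proof -
    have "poly (char_poly B) a = 0"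
      using that by (auto simp: as poly_prod_list prod_list_zero_iff)
    then obtain v where "eigenvector B v a"
      using eigenvalue_root_char_poly[OF B] by (auto simp: eigenvalue_def)
    then have v: "v \<in> carrier_vec n" "v \<noteq> 0\<^sub>v n" "B *\<^sub>v v = a \<cdot>\<^sub>v v"
      using B by (auto simp: eigenvector_def)
    have "a * (v \<bullet>c v) = (B *\<^sub>v v) \<bullet>c v"
      using v by simp
    also have "\<dots> = v \<bullet> (B *\<^sub>v conjugate v)"
      using transpose_vec_mult_scalar[OF B, of "conjugate v" v] v symB by simp
    also have "\<dots> = v \<bullet> conjugate (a \<cdot>\<^sub>v v)"
      using conj[OF v(1)] v by simp
    also have "\<dots> = cnj a * (v \<bullet>c v)"
      using v by (simp add: conjugate_smult_vec)
    finally have "a = cnj a" using v by simp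
    then show ?thesis by (simp add: complex_is_Real_iff complex_eq_iff)
  qed
  interpret map_poly_comm_ring_hom complex_of_real ..
  have "map_poly complex_of_real (char_poly A) = char_poly B"
    unfolding B_def by (rule of_real_hom.char_poly_hom[OF A, symmetric])
  also have "\<dots> = (\<Prod>a\<leftarrow>as. map_poly complex_of_real [:- Re a, 1:])"
    unfolding as using real by (intro arg_cong[of _ _ prod_list] map_cong) auto
  also have "\<dots> = map_poly complex_of_real (\<Prod>e\<leftarrow>map Re as. [:- e, 1:])"
    by (induction as) (simp_all add: hom_distribs)
  finally have "char_poly A = (\<Prod>e\<leftarrow>map Re as. [:- e, 1:])"
    by (simp add: poly_eq_iff coeff_map_poly del: map_map)
  then show ?thesis by blast
qed

text \<open>
A basis starting with \<open>v\<close> is orthogonalized by Gram-Schmidt, which keeps its first vector, and then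
normalized.
\<close>

lemma orthogonal_mat_with_first_col:
  fixes v :: "real vec"
  assumes v: "v \<in> carrier_vec n" "v \<noteq> 0\<^sub>v n"
  shows "\<exists>W \<in> carrier_mat n n. W\<^sup>T * W = 1\<^sub>m n \<and> (\<exists>c. col W 0 = c \<cdot>\<^sub>v v)"
proof -
  interpret cof_vec_space n "TYPE(real)" .
  define b where "b = basis_completion v"
  note b = basis_completion[OF v, folded b_def]
  define ws where "ws = gram_schmidt n b"
  have n: "n > 0" using v by (intro Nat.gr0I) auto
  have ws: "set ws \<subseteq> carrier_vec n" "corthogonal ws" "length ws = n"
    using gram_schmidt_result[OF b(2,4,5) ws_def] b(6) by auto
  have "b \<noteq> []" using b(6) n by auto
  then obtain bs where "b = v # bs" using b(7) by (cases b) auto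
  then have hd: "hd ws = v" using gram_schmidt_hd[OF v(1)] by (simp add: ws_def)
  have wsc: "ws ! i \<in> carrier_vec n" if "i < n" for i using ws that by auto
  have orth: "ws ! i \<bullet> ws ! j = 0 \<longleftrightarrow> i \<noteq> j" if "i < n" "j < n" for i j
    using ws that by (auto simp: corthogonal_def)
  have pos: "ws ! i \<bullet> ws ! i > 0" if "i < n" for i
    using orth[of i i] that by (simp add: scalar_prod_def less_le sum_nonneg)
  define W where "W = mat_of_cols n (map (\<lambda>w. (1 / vec_norm2 w) \<cdot>\<^sub>v w) ws)"
  have W: "W \<in> carrier_mat n n" using ws by (auto simp: W_def)
  have col: "col W i = (1 / vec_norm2 (ws ! i)) \<cdot>\<^sub>v ws ! i" if "i < n" for i
    using that ws wsc[OF that] by (auto simp: W_def)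
  have "W\<^sup>T * W = 1\<^sub>m n"
  proof (rule eq_matI)
    fix i j assume "i < dim_row (1\<^sub>m n :: real mat)" "j < dim_col (1\<^sub>m n :: real mat)"
    then have ij: "i < n" "j < n" by auto
    have "(W\<^sup>T * W) $$ (i, j) = col W i \<bullet> col W j" using W ij by simp
    also have "\<dots> = (ws ! i \<bullet> ws ! j) / (vec_norm2 (ws ! i) * vec_norm2 (ws ! j))"
      using ij carrier_vecD[OF wsc] by (simp add: col)
    also have "\<dots> = 1\<^sub>m n $$ (i, j)"
      using ij orth[of i j] pos[of i] by (auto simp: vec_norm2_def)
    finally show "(W\<^sup>T * W) $$ (i, j) = 1\<^sub>m n $$ (i, j)" .
  qed (use W in auto)
  moreover have "col W 0 = (1 / vec_norm2 v) \<cdot>\<^sub>v v"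
    using col[OF n] hd ws n by (metis hd_conv_nth length_0_conv not_less0)
  ultimately show ?thesis using W by blast
qed

lemma mult_block_diagonal:
  fixes A B C D :: "'a :: comm_ring_1 mat"
  assumes "A \<in> carrier_mat p p" "C \<in> carrier_mat p p" "B \<in> carrier_mat q q" "D \<in> carrier_mat q q"
  shows "four_block_mat A (0\<^sub>m p q) (0\<^sub>m q p) B * four_block_mat C (0\<^sub>m p q) (0\<^sub>m q p) D
    = four_block_mat (A * C) (0\<^sub>m p q) (0\<^sub>m q p) (B * D)"
  using assms
  by (subst mult_four_block_mat[OF assms(1) zero_carrier_mat zero_carrier_mat assms(3,2)
        zero_carrier_mat zero_carrier_mat assms(4)]) simp

text \<open>
Deflation: in an orthonormal basis whose first vector is an eigenvector for \<open>e\<close>, symmetry clears the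
first row together with the first column, and a smaller symmetric block remains. The eigenvalues
come out in the order of the factorization that is supplied, so that a sorted diagonal costs nothing
more.
\<close>

lemma real_symmetric_diagonalization:
  fixes A :: "real mat"
  assumes "A \<in> carrier_mat n n" "A\<^sup>T = A" "char_poly A = (\<Prod>e\<leftarrow>es. [:- e, 1:])"
  shows "\<exists>Q \<in> carrier_mat n n. Q\<^sup>T * Q = 1\<^sub>m n \<and> Q\<^sup>T * A * Q = mat_diag n (\<lambda>i. es ! i)"
  using assms
proof (induction es arbitrary: n A)
  case Nil
  then have "n = 0" using degree_monic_char_poly[of A n] by simp
  then show ?case using Nil by (intro bexI[of _ "1\<^sub>m n"] conjI eq_matI) (auto simp: mat_diag_def)
next
  case (Cons e es)
  note A = Cons.prems(1) and sym = Cons.prems(2) and cp = Cons.prems(3)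
  have e: "eigenvalue A e" unfolding eigenvalue_root_char_poly[OF A] cp by simp
  then obtain v where v: "v \<in> carrier_vec n" "v \<noteq> 0\<^sub>v n" "A *\<^sub>v v = e \<cdot>\<^sub>v v"
    using A by (auto simp: eigenvalue_def eigenvector_def)
  obtain W c where W: "W \<in> carrier_mat n n" "W\<^sup>T * W = 1\<^sub>m n" and c: "col W 0 = c \<cdot>\<^sub>v v"
    using orthogonal_mat_with_first_col[OF v(1,2)] by auto
  have W': "W * W\<^sup>T = 1\<^sub>m n" using mat_mult_left_right_inverse[OF _ _ W(2)] W(1) by auto
  have n: "n > 0" using v by (intro Nat.gr0I) auto
  define l where "l = n - 1"
  have nl: "n = Suc l" using n by (simp add: l_def)
  define A' where "A' = W\<^sup>T * A * W"
  have A': "A' \<in> carrier_mat n n" using A W by (auto simp: A'_def)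
  have symA': "A'\<^sup>T = A'"
    using A W sym by (simp add: A'_def transpose_mult_dim assoc_mult_mat_dim)
  have col0: "col A' 0 = e \<cdot>\<^sub>v unit_vec n 0"
  proof -
    have "col A' 0 = (W\<^sup>T * A) *\<^sub>v col W 0"
      unfolding A'_def using A W n by (intro col_mult2) auto
    also have "\<dots> = W\<^sup>T *\<^sub>v (A *\<^sub>v col W 0)"
      using A W n by (intro assoc_mult_mat_vec) auto
    also have "A *\<^sub>v col W 0 = e \<cdot>\<^sub>v col W 0"
      unfolding c using v A by (simp add: mult_mat_vec[OF A v(1)] smult_smult_assoc mult.commute)
    also have "W\<^sup>T *\<^sub>v (e \<cdot>\<^sub>v col W 0) = e \<cdot>\<^sub>v (W\<^sup>T *\<^sub>v col W 0)"
      using W by (intro mult_mat_vec) auto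
    also have "W\<^sup>T *\<^sub>v col W 0 = col (W\<^sup>T * W) 0"
      using W n by (intro col_mult2[symmetric]) auto
    finally show ?thesis using W n by simp
  qed
  have A'0: "A' $$ (i, 0) = (if i = 0 then e else 0)" if "i < n" for i
    using arg_cong[OF col0, of "\<lambda>w. w $ i"] that A' n by auto
  have A'0': "A' $$ (0, i) = (if i = 0 then e else 0)" if "i < n" for i
    using A'0[OF that] arg_cong[OF symA', of "\<lambda>M. M $$ (i, 0)"] A' that n by auto
  define A3 where "A3 = mat l l (\<lambda>(i, j). A' $$ (Suc i, Suc j))"
  have A3: "A3 \<in> carrier_mat l l" by (simp add: A3_def)
  have block: "A' = four_block_mat (mat 1 1 (\<lambda>_. e)) (0\<^sub>m 1 l) (0\<^sub>m l 1) A3"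
    using A' A'0 A'0' nl by (intro eq_matI) (auto simp: A3_def)
  have symA3: "A3\<^sup>T = A3"
  proof (rule eq_matI)
    fix i j assume "i < dim_row A3" "j < dim_col A3"
    then show "A3\<^sup>T $$ (i, j) = A3 $$ (i, j)"
      using arg_cong[OF symA', of "\<lambda>M. M $$ (Suc i, Suc j)"] A' nl by (simp add: A3_def)
  qed (auto simp: A3_def)
  have "similar_mat A' A"
    unfolding similar_mat_def A'_def
    by (rule exI[of _ "W\<^sup>T"], rule exI[of _ W], rule similar_mat_witI[of _ _ n])
      (use A W W' in auto)
  then have "char_poly A' = char_poly A" by (rule char_poly_similar)
  moreover have "char_poly A' = char_poly (mat 1 1 (\<lambda>_. e)) * char_poly A3"
    unfolding block by (rule char_poly_four_block_zeros_col) (use A3 in auto)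
  moreover have "char_poly (mat 1 1 (\<lambda>_. e)) = [:- e, 1:]"
    by (simp add: char_poly_defs det_def sign_def)
  ultimately have "[:- e, 1:] * char_poly A3 = [:- e, 1:] * (\<Prod>e\<leftarrow>es. [:- e, 1:])"
    using cp by simp
  then have "char_poly A3 = (\<Prod>e\<leftarrow>es. [:- e, 1:])"
    by (metis mult_cancel_left pCons_eq_0_iff zero_neq_one)
  from Cons.IH[OF A3 symA3 this] obtain R where R: "R \<in> carrier_mat l l" "R\<^sup>T * R = 1\<^sub>m l"
    and RA: "R\<^sup>T * A3 * R = mat_diag l (\<lambda>i. es ! i)" by auto
  define F where "F = four_block_mat (1\<^sub>m 1) (0\<^sub>m 1 l) (0\<^sub>m l 1) R"
  have F: "F \<in> carrier_mat n n" using R nl by (auto simp: F_def)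
  have FT: "F\<^sup>T = four_block_mat (1\<^sub>m 1) (0\<^sub>m 1 l) (0\<^sub>m l 1) (R\<^sup>T)"
    unfolding F_def by (subst transpose_four_block_mat) (use R in auto)
  have FF: "F\<^sup>T * F = 1\<^sub>m n"
    unfolding F_def FT[unfolded F_def]
    by (subst mult_block_diagonal) (use R nl in auto)
  have FAF: "F\<^sup>T * A' * F = four_block_mat (mat 1 1 (\<lambda>_. e)) (0\<^sub>m 1 l) (0\<^sub>m l 1) (R\<^sup>T * A3 * R)"
    unfolding block F_def FT[unfolded F_def]
    using R A3 by (simp add: mult_block_diagonal)
  define Q where "Q = W * F"
  have Q: "Q \<in> carrier_mat n n" using W F by (simp add: Q_def)
  have "Q\<^sup>T * Q = F\<^sup>T * (W\<^sup>T * W) * F"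
    using W(1) F by (simp add: Q_def transpose_mult_dim assoc_mult_mat_dim)
  then have QQ: "Q\<^sup>T * Q = 1\<^sub>m n" unfolding W(2) using F FF by simp
  have "Q\<^sup>T * A * Q = F\<^sup>T * A' * F"
    using W F A by (simp add: Q_def A'_def transpose_mult_dim assoc_mult_mat_dim)
  also have "\<dots> = mat_diag n (\<lambda>i. (e # es) ! i)"
    unfolding FAF RA using nl by (intro eq_matI) (auto simp: mat_diag_def nth_Cons')
  finally show ?case using Q QQ by blast
qed

lemma real_symmetric_sorted_diagonalization:
  fixes A :: "real mat"
  assumes A: "A \<in> carrier_mat n n" and sym: "A\<^sup>T = A"
  shows "\<exists>Q d. Q \<in> carrier_mat n n \<and> Q\<^sup>T * Q = 1\<^sub>m n \<and> Q\<^sup>T * A * Q = mat_diag n d \<and>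
    (\<forall>i j. i \<le> j \<longrightarrow> j < n \<longrightarrow> d i \<le> d j)"
proof -
  obtain es where es: "char_poly A = (\<Prod>e\<leftarrow>es. [:- e, 1:])"
    using real_symmetric_char_poly_splits[OF A sym] by auto
  have "mset (map (\<lambda>e. [:- e, 1:]) (sort es)) = mset (map (\<lambda>e. [:- e, 1:]) es)"
    by simp
  then have "char_poly A = (\<Prod>e\<leftarrow>sort es. [:- e, 1:])"
    unfolding es by (metis prod_mset_prod_list)
  then obtain Q where Q: "Q \<in> carrier_mat n n" "Q\<^sup>T * Q = 1\<^sub>m n"
    "Q\<^sup>T * A * Q = mat_diag n (\<lambda>i. sort es ! i)"
    using real_symmetric_diagonalization[OF A sym, of "sort es"] by blast
  have "degree (char_poly A) = length es"
    unfolding es by (rule degree_linear_factors)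
  then have "length (sort es) = n"
    using degree_monic_char_poly[OF A] by simp
  then have "\<forall>i j. i \<le> j \<longrightarrow> j < n \<longrightarrow> sort es ! i \<le> sort es ! j"
    by (auto intro!: sorted_nth_mono)
  then show ?thesis using Q by blast
qed

section \<open>Canonical angles between a subspace and a graph over it\<close>

lemma vspan_cols_mult_invertible:
  assumes M: "M \<in> carrier_mat n k" and G: "G \<in> carrier_mat k k" and H: "H \<in> carrier_mat k k"
    and GH: "G * H = 1\<^sub>m k"
  shows "vspan n (set (cols (M * G))) = vspan n (set (cols M))"
proof -
  have MG: "M * G \<in> carrier_mat n k" using M G by auto
  have 1: "(M * G) *\<^sub>v w = M *\<^sub>v (G *\<^sub>v w)" if "w \<in> carrier_vec k" for w
    using that M G by auto
  have 2: "G *\<^sub>v (H *\<^sub>v w) = w" if "w \<in> carrier_vec k" for w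
    using that G H GH assoc_mult_mat_vec[of G k k H k w] by simp
  have "G *\<^sub>v w \<in> carrier_vec k" "H *\<^sub>v w \<in> carrier_vec k" if "w \<in> carrier_vec k" for w
    using that G H by auto
  then show ?thesis
    unfolding vspan_cols[OF M] vspan_cols[OF MG] using 1 2 by (force simp: image_iff)
qed

lemma append_zero_rows [simp]: "dim_col M = l \<Longrightarrow> M @\<^sub>r 0\<^sub>m 0 l = (M :: 'a :: zero mat)"
  by (intro eq_matI) (auto simp: append_rows_def)

lemma dim_mat_diag [simp]: "dim_row (mat_diag k d) = k" "dim_col (mat_diag k d) = k"
  by (simp_all add: mat_diag_def)

lemma transpose_mat_diag [simp]: "(mat_diag k d)\<^sup>T = mat_diag k d"
  by (intro eq_matI) (auto simp: mat_diag_def)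

lemma one_plus_mat_diag: "1\<^sub>m k + mat_diag k d = mat_diag k (\<lambda>i. 1 + d i :: real)"
  by (intro eq_matI) (auto simp: mat_diag_def)

text \<open>
The setting below is that of a graph: if \<open>Z = X + Y D\<close>, where \<open>X\<close> and \<open>Y\<close> together have orthonormal
columns, then the span of \<open>Z\<close> is the graph of \<open>D\<close> over the span of \<open>X\<close>. The three Gram matrices
carry all that the angles between the two spans depend on, so \<open>Y\<close> is not mentioned.
\<close>

context
  fixes n k p :: nat and X Z D :: "real mat"
  assumes X: "X \<in> carrier_mat n k" and Z: "Z \<in> carrier_mat n k" and D: "D \<in> carrier_mat p k"
    and XX: "X\<^sup>T * X = 1\<^sub>m k" and XZ: "X\<^sup>T * Z = 1\<^sub>m k" and ZZ: "Z\<^sup>T * Z = 1\<^sub>m k + D\<^sup>T * D"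
begin

lemma gram_of_graph_basis:
  assumes S: "S \<in> carrier_mat k k" "S\<^sup>T * S = 1\<^sub>m k"
  shows "S\<^sup>T * (Z\<^sup>T * Z) * S = 1\<^sub>m k + S\<^sup>T * (D\<^sup>T * D) * S"
proof -
  have "S\<^sup>T * (Z\<^sup>T * Z) * S = (S\<^sup>T * 1\<^sub>m k + S\<^sup>T * (D\<^sup>T * D)) * S"
    unfolding ZZ using S D by (subst mult_add_distrib_mat[of _ k k]) auto
  also have "\<dots> = S\<^sup>T * 1\<^sub>m k * S + S\<^sup>T * (D\<^sup>T * D) * S"
    using S D by (intro add_mult_distrib_mat[of _ k k]) auto
  finally show ?thesis using S by simp
qed

text \<open>
If \<open>Q\<close> diagonalizes \<open>D\<^sup>T D\<close> with eigenvalues \<open>d\<^sub>i\<close>, then the columns of \<open>Z Q\<close> are orthogonal with squared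
lengths \<open>1 + d\<^sub>i\<close>. Scaling them to unit length gives an orthonormal basis \<open>Y\<close> of the span of \<open>Z\<close> for which
\<open>X\<^sup>T Y\<close> is \<open>Q\<close> times a diagonal matrix. This already is a singular value decomposition, and the angles are
\<open>arctan (sqrt d\<^sub>i)\<close>; no decomposition of a general matrix has to be constructed.
\<close>

lemma canonical_angles_of_graph_exist:
  "\<exists>\<theta>. is_canonical_angles n k (vspan n (set (cols X))) (vspan n (set (cols Z))) \<theta>"
proof -
  have DD: "D\<^sup>T * D \<in> carrier_mat k k" "(D\<^sup>T * D)\<^sup>T = D\<^sup>T * D"
    using D by (auto simp: transpose_mult_dim)
  obtain Q d where Q: "Q \<in> carrier_mat k k" "Q\<^sup>T * Q = 1\<^sub>m k"
    and Qd: "Q\<^sup>T * (D\<^sup>T * D) * Q = mat_diag k d"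
    and sorted: "\<And>i j. i \<le> j \<Longrightarrow> j < k \<Longrightarrow> d i \<le> d j"
    using real_symmetric_sorted_diagonalization[OF DD] by metis
  have d0: "0 \<le> d i" if i: "i < k" for i
  proof -
    have "mat_diag k d = (D * Q)\<^sup>T * (D * Q)"
      unfolding Qd[symmetric] using D Q(1) by (simp add: transpose_mult_dim assoc_mult_mat_dim)
    then have "mat_diag k d $$ (i, i) = ((D * Q)\<^sup>T * (D * Q)) $$ (i, i)" by simp
    moreover have "((D * Q)\<^sup>T * (D * Q)) $$ (i, i) = row ((D * Q)\<^sup>T) i \<bullet> col (D * Q) i"
      using i D Q(1) by (intro index_mult_mat(1)) auto
    moreover have "row ((D * Q)\<^sup>T) i = col (D * Q) i"
      using i Q(1) by (intro row_transpose) auto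
    ultimately have "d i = col (D * Q) i \<bullet> col (D * Q) i"
      using i by (simp add: mat_diag_def)
    then show ?thesis by (simp add: scalar_prod_def sum_nonneg)
  qed
  \<comment> \<open>The cosines of the angles, which are also the scaling factors of the columns of \<open>Z Q\<close>.\<close>
  define c where "c = (\<lambda>i. 1 / sqrt (1 + d i))"
  have c: "c i * (1 + d i) * c i = 1" if "i < k" for i
    using d0[OF that] by (simp add: c_def field_simps)
  have c0: "c i \<noteq> 0" if "i < k" for i using c[OF that] by auto
  define \<theta> where "\<theta> = vec k (\<lambda>i. arctan (sqrt (d i)))"
  have cos: "cos (\<theta> $ i) = c i" if "i < k" for i
    using that d0[OF that] by (simp add: \<theta>_def c_def cos_arctan)
  let ?C = "mat_diag k c"
  let ?C' = "mat_diag k (\<lambda>i. 1 / c i)"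
  have C: "?C \<in> carrier_mat k k" "?C' \<in> carrier_mat k k" by auto
  have CC: "?C * ?C' = 1\<^sub>m k"
    unfolding mat_diag_diag using c0 by (auto simp: mat_diag_def intro!: eq_matI)
  have QQ': "Q * Q\<^sup>T = 1\<^sub>m k" using mat_mult_left_right_inverse[OF _ _ Q(2)] Q(1) by auto
  define Y where "Y = Z * (Q * ?C)"
  have Y: "Y \<in> carrier_mat n k" using Z Q by (auto simp: Y_def)
  have "(Q * ?C) * (?C' * Q\<^sup>T) = Q * (?C * ?C') * Q\<^sup>T"
    using Q(1) C by (simp add: assoc_mult_mat_dim del: mat_diag_diag)
  then have "(Q * ?C) * (?C' * Q\<^sup>T) = 1\<^sub>m k"
    unfolding CC using Q(1) QQ' by simp
  then have spanY: "vspan n (set (cols Y)) = vspan n (set (cols Z))"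
    unfolding Y_def using Z Q C
    by (intro vspan_cols_mult_invertible[of _ _ k _ "?C' * Q\<^sup>T"]) auto
  have "Y\<^sup>T * Y = ?C * (Q\<^sup>T * (Z\<^sup>T * Z) * Q) * ?C"
    using Z Q(1) C by (simp add: Y_def transpose_mult_dim assoc_mult_mat_dim)
  also have "\<dots> = mat_diag k (\<lambda>i. c i * (1 + d i) * c i)"
    unfolding gram_of_graph_basis[OF Q] Qd one_plus_mat_diag by simp
  also have "\<dots> = 1\<^sub>m k"
    using c by (auto simp: mat_diag_def intro!: eq_matI)
  finally have orthY: "orthonormal_cols Y" using Y by (simp add: orthonormal_cols_def)
  have "X\<^sup>T * Y = X\<^sup>T * Z * (Q * ?C)"
    using X Z Q(1) C by (simp add: Y_def assoc_mult_mat_dim)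
  then have XY: "X\<^sup>T * Y = Q * ?C" unfolding XZ using Q C by simp
  have cosdiag: "mat_diag k (\<lambda>i. map_vec cos \<theta> $ i) = ?C"
    using cos by (intro eq_matI) (auto simp: mat_diag_def \<theta>_def)
  have cmono: "c j \<le> c i" if "i \<le> j" "j < k" for i j
  proof -
    have "0 \<le> d i" using d0 that by simp
    then show ?thesis using sorted[OF that] by (auto simp: c_def intro!: frac_le)
  qed
  have "is_svd k k (X\<^sup>T * Y) Q (map_vec cos \<theta>) (1\<^sub>m k)"
    unfolding is_svd_def
  proof (intro conjI allI impI)
    show "orthonormal_cols Q" "orthonormal_cols (1\<^sub>m k)" using Q by (auto simp: orthonormal_cols_def)
    show "map_vec cos \<theta> \<in> carrier_vec k" by (simp add: \<theta>_def)
    show "0 \<le> map_vec cos \<theta> $ i" if "i < k" for i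
      using that cos[OF that] d0[OF that] by (simp add: \<theta>_def c_def)
    show "map_vec cos \<theta> $ j \<le> map_vec cos \<theta> $ i" if "i \<le> j" "j < k" for i j
      using that cos[of i] cos[of j] cmono[OF that] by (simp add: \<theta>_def)
    show "X\<^sup>T * Y = Q * (mat_diag k (\<lambda>i. map_vec cos \<theta> $ i) @\<^sub>r 0\<^sub>m (k - k) k) * (1\<^sub>m k)\<^sup>T"
      unfolding XY cosdiag using Q C by simp
  qed (use Q in auto)
  moreover have "0 \<le> \<theta> $ i \<and> \<theta> $ i \<le> pi / 2" if "i < k" for i
    using that d0[OF that] arctan_ubound[of "sqrt (d i)"] by (simp add: \<theta>_def)
  moreover have "orthonormal_cols X" using X XX by (simp add: orthonormal_cols_def)
  ultimately have "is_canonical_angles n k (vspan n (set (cols X))) (vspan n (set (cols Z))) \<theta>"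
    unfolding is_canonical_angles_def using X Y orthY spanY
    by (intro conjI bexI[of _ X] bexI[of _ Y]) (auto simp: \<theta>_def)
  then show ?thesis by blast
qed

text \<open>
Uniqueness of the angles, in the form in which it is used: whichever bases and singular vectors
witness \<open>\<theta>\<close>, they produce an orthogonal diagonalization of \<open>D\<^sup>T D\<close> by the squared tangents. Any
orthonormal basis of the span of \<open>X\<close> is \<open>X T\<close> with \<open>T\<close> orthogonal, any one of the span of \<open>Z\<close> is \<open>Z R\<close>,
and the singular value decomposition of \<open>(X T)\<^sup>T Z R = T\<^sup>T R\<close> expresses \<open>R\<close> as \<open>S (cos \<theta>) W\<^sup>T\<close> with
\<open>S\<close> orthogonal. Orthonormality of \<open>Z R\<close> then reads \<open>cos \<theta> (1 + S\<^sup>T D\<^sup>T D S) cos \<theta> = 1\<close>, which excludes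
right angles and yields \<open>1 / cos\<^sup>2 - 1 = tan\<^sup>2\<close>.
\<close>

lemma tan_canonical_angles_of_graph:
  assumes \<theta>: "is_canonical_angles n k (vspan n (set (cols X))) (vspan n (set (cols Z))) \<theta>"
  shows "\<exists>S \<in> carrier_mat k k. S\<^sup>T * S = 1\<^sub>m k \<and>
    S\<^sup>T * (D\<^sup>T * D) * S = mat_diag k (\<lambda>i. (tan (\<theta> $ i))\<^sup>2) \<and> (\<forall>i<k. \<theta> $ i < pi / 2)"
proof -
  obtain QX QY P W where QX: "QX \<in> carrier_mat n k" "orthonormal_cols QX"
      "vspan n (set (cols QX)) = vspan n (set (cols X))"
    and QY: "QY \<in> carrier_mat n k" "orthonormal_cols QY"
      "vspan n (set (cols QY)) = vspan n (set (cols Z))"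
    and svd: "is_svd k k (QX\<^sup>T * QY) P (map_vec cos \<theta>) W"
    and \<theta>c: "\<theta> \<in> carrier_vec k" and \<theta>r: "\<And>i. i < k \<Longrightarrow> 0 \<le> \<theta> $ i \<and> \<theta> $ i \<le> pi / 2"
    using \<theta> unfolding is_canonical_angles_def by blast
  have QXX: "QX\<^sup>T * QX = 1\<^sub>m k" and QYY: "QY\<^sup>T * QY = 1\<^sub>m k"
    using QX QY by (auto simp: orthonormal_cols_def)
  define c where "c = (\<lambda>i. cos (\<theta> $ i))"
  let ?C = "mat_diag k c"
  have C: "?C \<in> carrier_mat k k" by auto
  have P: "P \<in> carrier_mat k k" "orthonormal_cols P" and W: "W \<in> carrier_mat k k" "orthonormal_cols W"
    using svd by (auto simp: is_svd_def)
  note PP = orthonormal_cols_square[OF P] and WW = orthonormal_cols_square[OF W]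
  have "mat_diag k (\<lambda>i. map_vec cos \<theta> $ i) = ?C"
    using \<theta>c by (intro eq_matI) (auto simp: mat_diag_def c_def)
  then have XY: "QX\<^sup>T * QY = P * ?C * W\<^sup>T"
    using svd C by (simp add: is_svd_def)
  obtain T where T: "T \<in> carrier_mat k k" "QX = X * T"
    using vspan_cols_subset_factor[OF X QX(1)] QX(3) by auto
  obtain R where R: "R \<in> carrier_mat k k" "QY = Z * R"
    using vspan_cols_subset_factor[OF Z QY(1)] QY(3) by auto
  have "QX\<^sup>T * QX = T\<^sup>T * (X\<^sup>T * X) * T"
    unfolding T(2) using X T(1) by (simp add: transpose_mult_dim assoc_mult_mat_dim)
  then have TT: "T\<^sup>T * T = 1\<^sub>m k"
    unfolding XX using QXX T(1) by simp
  then have TT': "T * T\<^sup>T = 1\<^sub>m k" using mat_mult_left_right_inverse[OF _ _ TT] T(1) by auto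
  have "QX\<^sup>T * QY = T\<^sup>T * (X\<^sup>T * Z) * R"
    unfolding T(2) R(2) using X Z T(1) R(1) by (simp add: transpose_mult_dim assoc_mult_mat_dim)
  then have TR: "T\<^sup>T * R = P * ?C * W\<^sup>T" unfolding XZ using XY T(1) by simp
  define S where "S = T * P"
  have S: "S \<in> carrier_mat k k" using T P by (simp add: S_def)
  have "S\<^sup>T * S = P\<^sup>T * (T\<^sup>T * T) * P"
    using T(1) P(1) by (simp add: S_def transpose_mult_dim assoc_mult_mat_dim)
  then have SS: "S\<^sup>T * S = 1\<^sub>m k" unfolding TT using P PP by simp
  have "(T * T\<^sup>T) * R = T * (T\<^sup>T * R)"
    using T(1) R(1) by (simp add: assoc_mult_mat_dim)
  also have "\<dots> = S * ?C * W\<^sup>T"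
    unfolding TR S_def using T(1) P(1) W(1) C by (simp add: assoc_mult_mat_dim)
  finally have R': "R = S * ?C * W\<^sup>T" unfolding TT' using R(1) by simp
  define G where "G = S\<^sup>T * (D\<^sup>T * D) * S"
  have G: "G \<in> carrier_mat k k" using S D by (auto simp: G_def)
  have "R * W = S * ?C * (W\<^sup>T * W)"
    unfolding R' using S C W(1) by (simp add: assoc_mult_mat_dim)
  then have RW: "R * W = S * ?C" unfolding WW(1) using S C by simp
  have "W\<^sup>T * (QY\<^sup>T * QY) * W = (R * W)\<^sup>T * (Z\<^sup>T * Z) * (R * W)"
    unfolding R(2) using Z R(1) W(1) by (simp add: transpose_mult_dim assoc_mult_mat_dim)
  also have "\<dots> = ?C * (S\<^sup>T * (Z\<^sup>T * Z) * S) * ?C"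
    unfolding RW using Z S C by (simp add: transpose_mult_dim assoc_mult_mat_dim)
  also have "\<dots> = ?C * (1\<^sub>m k + G) * ?C"
    unfolding gram_of_graph_basis[OF S SS] G_def ..
  finally have "?C * (1\<^sub>m k + G) * ?C = 1\<^sub>m k"
    unfolding QYY using W(1) WW(1) by simp
  moreover have "?C * (1\<^sub>m k + G) * ?C = mat k k (\<lambda>(i, j). c i * (1\<^sub>m k + G) $$ (i, j) * c j)"
  proof -
    have "?C * (1\<^sub>m k + G) = mat k k (\<lambda>(i, j). c i * (1\<^sub>m k + G) $$ (i, j))"
      using G by (intro mat_diag_mult_left) auto
    then show ?thesis by (simp, subst mat_diag_mult_right[of _ k]) (auto intro!: eq_matI)
  qed
  ultimately have "mat k k (\<lambda>(i, j). c i * (1\<^sub>m k + G) $$ (i, j) * c j) = 1\<^sub>m k" by simp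
  then have entry: "c i * ((if i = j then 1 else 0) + G $$ (i, j)) * c j = (if i = j then 1 else 0)"
    if "i < k" "j < k" for i j
    using that G by (auto dest!: arg_cong[of _ _ "\<lambda>M. M $$ (i, j)"] split: if_splits)
  have c0: "c i \<noteq> 0" if "i < k" for i using entry[OF that that] by auto
  have "G = mat_diag k (\<lambda>i. (tan (\<theta> $ i))\<^sup>2)"
  proof (rule eq_matI)
    fix i j assume "i < dim_row (mat_diag k (\<lambda>i. (tan (\<theta> $ i))\<^sup>2))" "j < dim_col (mat_diag k (\<lambda>i. (tan (\<theta> $ i))\<^sup>2))"
    then have ij: "i < k" "j < k" by (auto simp: mat_diag_def)
    show "G $$ (i, j) = mat_diag k (\<lambda>i. (tan (\<theta> $ i))\<^sup>2) $$ (i, j)"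
    proof (cases "i = j")
      case True
      have "1 + G $$ (i, i) = inverse (c i) ^ 2"
        using entry[of i i] c0[of i] ij by (simp add: field_simps power2_eq_square)
      then show ?thesis using True ij c0[of i] tan_sec[of "\<theta> $ i"] by (simp add: mat_diag_def c_def)
    next
      case False
      then show ?thesis using entry[OF ij] c0 ij by (simp add: mat_diag_def)
    qed
  qed (use G in auto)
  moreover have "\<theta> $ i < pi / 2" if "i < k" for i
    using \<theta>r[OF that] c0[OF that] by (cases "\<theta> $ i = pi / 2") (auto simp: c_def)
  ultimately show ?thesis using S SS by (auto simp: G_def)
qed

text \<open>
Both norms are attained at the largest angle, so the formula for the sine is the identity
\<open>sin = tan / sqrt (1 + tan\<^sup>2)\<close> at that angle.
\<close>

theorem norm_sin_tan_canonical_angles_of_graph: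
  assumes k: "k > 0"
  defines "VX \<equiv> vspan n (set (cols X))" and "VZ \<equiv> vspan n (set (cols Z))"
  shows "mat_norm2 (fun_Theta tan n k VX VZ) = mat_norm2 D"
    and "mat_norm2 (fun_Theta sin n k VX VZ) = mat_norm2 D / sqrt (1 + (mat_norm2 D)\<^sup>2)"
proof -
  define \<theta> where "\<theta> = canonical_angles n k VX VZ"
  have \<theta>: "is_canonical_angles n k VX VZ \<theta>"
    unfolding \<theta>_def canonical_angles_def
    by (rule someI_ex) (use canonical_angles_of_graph_exist in \<open>auto simp: VX_def VZ_def\<close>)
  obtain S where S: "S \<in> carrier_mat k k" "S\<^sup>T * S = 1\<^sub>m k"
    and SD: "S\<^sup>T * (D\<^sup>T * D) * S = mat_diag k (\<lambda>i. (tan (\<theta> $ i))\<^sup>2)"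
    and ub: "\<And>i. i < k \<Longrightarrow> \<theta> $ i < pi / 2"
    using tan_canonical_angles_of_graph[of \<theta>] \<theta> unfolding VX_def VZ_def by auto
  have lb: "0 \<le> \<theta> $ i" if "i < k" for i
    using \<theta> that unfolding is_canonical_angles_def by auto
  let ?B = "mat_diag k (\<lambda>i. tan (\<theta> $ i))"
  have "?B\<^sup>T * ?B = mat_diag k (\<lambda>i. (tan (\<theta> $ i))\<^sup>2)" by (simp add: power2_eq_square)
  then have DB: "mat_norm2 D = mat_norm2 ?B"
    by (intro mat_norm2_eq_if_gram_eq[OF D mat_diag_dim S]) (simp add: SD)
  then show tan: "mat_norm2 (fun_Theta tan n k VX VZ) = mat_norm2 D"
    by (simp add: fun_Theta_def \<theta>_def)
  have "Max ((\<lambda>i. \<theta> $ i) ` {..<k}) \<in> (\<lambda>i. \<theta> $ i) ` {..<k}"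
    using k by (intro Max_in) auto
  then obtain j where j: "j < k" "\<theta> $ j = Max ((\<lambda>i. \<theta> $ i) ` {..<k})" by auto
  then have max: "\<theta> $ i \<le> \<theta> $ j" if "i < k" for i using that by simp
  have tanmono: "\<bar>tan (\<theta> $ i)\<bar> \<le> \<bar>tan (\<theta> $ j)\<bar>" if i: "i < k" for i
    using tan_mono_le[of 0 "\<theta> $ i"] tan_mono_le[of "\<theta> $ i" "\<theta> $ j"]
      lb[OF i] ub[OF i] ub[OF j(1)] max[OF i] by simp
  have sinmono: "\<bar>sin (\<theta> $ i)\<bar> \<le> \<bar>sin (\<theta> $ j)\<bar>" if i: "i < k" for i
    using sin_mono_le_eq[of 0 "\<theta> $ i"] sin_mono_le_eq[of "\<theta> $ i" "\<theta> $ j"]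
      lb[OF i] ub[OF i] ub[OF j(1)] max[OF i] by simp
  have nD: "mat_norm2 D = \<bar>tan (\<theta> $ j)\<bar>"
    unfolding DB using j(1) tanmono by (rule mat_norm2_diag)
  have nS: "mat_norm2 (fun_Theta sin n k VX VZ) = \<bar>sin (\<theta> $ j)\<bar>"
    unfolding fun_Theta_def \<theta>_def[symmetric] using j(1) sinmono by (rule mat_norm2_diag)
  have "\<bar>\<theta> $ j\<bar> < pi / 2" using lb[OF j(1)] ub[OF j(1)] by simp
  from sin_tan[OF this]
  show "mat_norm2 (fun_Theta sin n k VX VZ) = mat_norm2 D / sqrt (1 + (mat_norm2 D)\<^sup>2)"
    unfolding nD nS by simp
qed

end

section \<open>Lagrange interpolation and the entries of \<open>\<Delta>\<^sub>k\<close>\<close>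

definition lagrange_basis :: "nat set \<Rightarrow> (nat \<Rightarrow> real) \<Rightarrow> nat \<Rightarrow> real poly" where
  "lagrange_basis I x i = (\<Prod>l\<in>I - {i}. smult (1 / (x i - x l)) [:- x l, 1:])"

lemma poly_lagrange_basis:
  "poly (lagrange_basis I x i) t = (\<Prod>l\<in>I - {i}. (t - x l) / (x i - x l))"
  by (simp add: lagrange_basis_def poly_prod diff_divide_distrib)

lemma poly_lagrange_basis_node:
  assumes "finite I" "inj_on x I" "i \<in> I" "j \<in> I"
  shows "poly (lagrange_basis I x i) (x j) = (if i = j then 1 else 0)"
proof (cases "i = j")
  case True
  have "x i \<noteq> x l" if "l \<in> I - {i}" for l using assms that by (auto dest: inj_onD)
  then show ?thesis using True by (auto simp: poly_lagrange_basis intro!: prod.neutral)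
next
  case False
  then show ?thesis using assms by (auto simp: poly_lagrange_basis prod_zero_iff)
qed

lemma degree_lagrange_basis:
  assumes "finite I" "i \<in> I"
  shows "degree (lagrange_basis I x i) < card I"
proof -
  have "degree (lagrange_basis I x i) \<le> (\<Sum>l\<in>I - {i}. degree (smult (1 / (x i - x l)) [:- x l, 1:]))"
    unfolding lagrange_basis_def by (rule degree_prod_sum_le[unfolded o_def]) (use assms in simp)
  also have "\<dots> \<le> (\<Sum>l\<in>I - {i}. 1)"
    by (intro sum_mono order_trans[OF degree_smult_le]) simp
  also have "\<dots> < card I"
  proof -
    have "card I > 0" using assms card_gt_0_iff by blast
    then show ?thesis using assms by simp
  qed
  finally show ?thesis .
qed

lemma poly_eq_sum_lessThan:
  fixes p :: "'a :: comm_semiring_1 poly"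
  assumes "degree p < k"
  shows "poly p t = (\<Sum>j<k. t ^ j * coeff p j)"
proof -
  have "poly p t = (\<Sum>j\<le>degree p. coeff p j * t ^ j)" by (rule poly_altdef)
  also have "\<dots> = (\<Sum>j<k. coeff p j * t ^ j)"
    using assms by (intro sum.mono_neutral_left) (auto simp: coeff_eq_0)
  finally show ?thesis by (simp add: mult.commute)
qed

text \<open>
The result of the Gauss-Jordan algorithm is identified by exhibiting an inverse.
\<close>

lemma the_mat_inverse_eq:
  fixes A B :: "'a :: field mat"
  assumes A: "A \<in> carrier_mat k k" and B: "B \<in> carrier_mat k k" and AB: "A * B = 1\<^sub>m k"
  shows "the (mat_inverse A) = B"
proof -
  have BA: "B * A = 1\<^sub>m k" by (rule mat_mult_left_right_inverse[OF A B AB])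
  have "A \<in> Units (ring_mat TYPE('a) k ())"
    using A B AB BA by (auto simp: Units_def ring_mat_def intro!: bexI[of _ B])
  then obtain C where C: "mat_inverse A = Some C"
    using mat_inverse(1)[OF A, of "()"] by (cases "mat_inverse A") auto
  from mat_inverse(2)[OF A this] have C': "A * C = 1\<^sub>m k" "C \<in> carrier_mat k k" by auto
  have "C = (B * A) * C" using C' unfolding BA by simp
  also have "\<dots> = B * (A * C)" using A B C' by simp
  finally show ?thesis using C C' B by simp
qed

lemma append_rows_index:
  assumes "A \<in> carrier_mat p k" "B \<in> carrier_mat q k" "i < p + q" "j < k"
  shows "(A @\<^sub>r B) $$ (i, j) = (if i < p then A $$ (i, j) else B $$ (i - p, j))"
  using assms by (auto simp: append_rows_def)

lemma append_rows_mult: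
  fixes A B C :: "'a :: comm_semiring_0 mat"
  assumes "A \<in> carrier_mat p k" "B \<in> carrier_mat q k" "C \<in> carrier_mat k l"
  shows "(A @\<^sub>r B) * C = (A * C) @\<^sub>r (B * C)"
proof (rule eq_matI)
  fix i j assume "i < dim_row ((A * C) @\<^sub>r (B * C))" "j < dim_col ((A * C) @\<^sub>r (B * C))"
  then have ij: "i < p + q" "j < l" using assms by (auto simp: append_rows_def)
  have AB: "A @\<^sub>r B \<in> carrier_mat (p + q) k" using assms by auto
  have "((A @\<^sub>r B) * C) $$ (i, j) = (\<Sum>r\<in>{0..<k}. (A @\<^sub>r B) $$ (i, r) * C $$ (r, j))"
    using carrier_matD[OF AB] assms ij by (simp add: scalar_prod_def)
  also have "\<dots> = (\<Sum>r\<in>{0..<k}. (if i < p then A $$ (i, r) else B $$ (i - p, r)) * C $$ (r, j))"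
    using append_rows_index[OF assms(1,2) ij(1)] by (intro sum.cong) auto
  also have "\<dots> = ((A * C) @\<^sub>r (B * C)) $$ (i, j)"
    using assms ij by (subst append_rows_index[of _ p l _ q]) (auto simp: scalar_prod_def)
  finally show "((A @\<^sub>r B) * C) $$ (i, j) = ((A * C) @\<^sub>r (B * C)) $$ (i, j)" .
qed (use assms in \<open>auto simp: append_rows_def\<close>)

lemma append_rows_transpose_mult:
  fixes A B A' B' :: "'a :: comm_semiring_0 mat"
  assumes "A \<in> carrier_mat p k" "B \<in> carrier_mat q k" "A' \<in> carrier_mat p l" "B' \<in> carrier_mat q l"
  shows "(A @\<^sub>r B)\<^sup>T * (A' @\<^sub>r B') = A\<^sup>T * A' + B\<^sup>T * B'"
proof (rule eq_matI)
  fix i j assume "i < dim_row (A\<^sup>T * A' + B\<^sup>T * B')" "j < dim_col (A\<^sup>T * A' + B\<^sup>T * B')"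
  then have ij: "i < k" "j < l" using assms by auto
  have AB: "A @\<^sub>r B \<in> carrier_mat (p + q) k" "A' @\<^sub>r B' \<in> carrier_mat (p + q) l" using assms by auto
  have "((A @\<^sub>r B)\<^sup>T * (A' @\<^sub>r B')) $$ (i, j)
      = (\<Sum>r\<in>{0..<p + q}. (A @\<^sub>r B) $$ (r, i) * (A' @\<^sub>r B') $$ (r, j))"
    using carrier_matD[OF AB(1)] carrier_matD[OF AB(2)] ij by (simp add: scalar_prod_def)
  also have "\<dots> = (\<Sum>r\<in>{0..<p + q}. if r < p then A $$ (r, i) * A' $$ (r, j)
      else B $$ (r - p, i) * B' $$ (r - p, j))"
    using append_rows_index[OF assms(1,2)] append_rows_index[OF assms(3,4)] ij
    by (intro sum.cong) auto
  also have "\<dots> = (\<Sum>r\<in>{0..<p}. A $$ (r, i) * A' $$ (r, j)) +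
      (\<Sum>r\<in>{0..<q}. B $$ (r, i) * B' $$ (r, j))"
    by (subst sum.atLeastLessThan_concat[of 0 p "p + q", symmetric])
      (auto simp: sum.shift_bounds_nat_ivl[of _ 0 p q, simplified, symmetric] add.commute
        sum.atLeastLessThan_shift_0[of _ p])
  also have "\<dots> = (A\<^sup>T * A' + B\<^sup>T * B') $$ (i, j)"
    using assms ij by (simp add: scalar_prod_def)
  finally show "((A @\<^sub>r B)\<^sup>T * (A' @\<^sub>r B')) $$ (i, j) = (A\<^sup>T * A' + B\<^sup>T * B') $$ (i, j)" .
qed (use assms in \<open>auto simp: append_rows_def\<close>)

context
  fixes n k :: nat and \<sigma> \<gamma> :: "nat \<Rightarrow> real"
  assumes kn: "k \<le> n" and inj: "inj_on (\<lambda>i. (\<sigma> i)\<^sup>2) {1..k}"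
    and nonzero: "\<And>i. i \<in> {1..k} \<Longrightarrow> \<sigma> i * \<gamma> i \<noteq> 0"
begin

text \<open>
The inverse of the Vandermonde block \<open>T1\<close> has the coefficients of the Lagrange basis polynomials at the
nodes \<open>\<sigma>\<^sub>i\<^sup>2\<close> as its columns. Hence a row of \<open>T2 * B\<close> holds the values of these polynomials at a later
\<open>\<sigma>\<^sub>j\<^sup>2\<close>, which makes every entry of \<open>\<Delta>\<^sub>k\<close> explicit. The factorization says that, in the coordinates given by
the right singular vectors, the Krylov space is the graph of \<open>\<Delta>\<^sub>k\<close>.
\<close>

lemma Delta_mat_props:
  shows Delta_mat_eq: "Delta_mat n k \<sigma> \<gamma> = mat (n - k) k (\<lambda>(r, i).
      \<sigma> (Suc (r + k)) * \<gamma> (Suc (r + k)) *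
      poly (lagrange_basis {1..k} (\<lambda>i. (\<sigma> i)\<^sup>2) (Suc i)) ((\<sigma> (Suc (r + k)))\<^sup>2) /
      (\<sigma> (Suc i) * \<gamma> (Suc i)))"
    and D_T_factorization: "\<exists>G \<in> carrier_mat k k. \<exists>H \<in> carrier_mat k k. G * H = 1\<^sub>m k \<and>
      D_mat n \<sigma> \<gamma> * T_mat n k \<sigma> = (1\<^sub>m k @\<^sub>r Delta_mat n k \<sigma> \<gamma>) * G"
proof -
  let ?p = "\<lambda>i. lagrange_basis {1..k} (\<lambda>i. (\<sigma> i)\<^sup>2) (Suc i)"
  define D1 where "D1 = mat_diag k (\<lambda>i. \<sigma> (Suc i) * \<gamma> (Suc i))"
  define D1' where "D1' = mat_diag k (\<lambda>i. 1 / (\<sigma> (Suc i) * \<gamma> (Suc i)))"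
  define D2 where "D2 = mat_diag (n - k) (\<lambda>r. \<sigma> (Suc (r + k)) * \<gamma> (Suc (r + k)))"
  define T1 where "T1 = mat k k (\<lambda>(i, j). \<sigma> (Suc i) ^ (2 * j))"
  define T2 where "T2 = mat (n - k) k (\<lambda>(r, j). \<sigma> (Suc (r + k)) ^ (2 * j))"
  define B where "B = mat k k (\<lambda>(j, i). coeff (?p i) j)"
  note carrier = D1_def D1'_def D2_def T1_def T2_def B_def
  have c: "D1 \<in> carrier_mat k k" "D1' \<in> carrier_mat k k" "D2 \<in> carrier_mat (n - k) (n - k)"
    "T1 \<in> carrier_mat k k" "T2 \<in> carrier_mat (n - k) k" "B \<in> carrier_mat k k"
    by (auto simp: carrier)
  have eval: "(\<Sum>j\<in>{0..<k}. t ^ (2 * j) * coeff (?p i) j) = poly (?p i) (t\<^sup>2)" if "i < k" for i t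
    using degree_lagrange_basis[of "{1..k}" "Suc i" "\<lambda>i. (\<sigma> i)\<^sup>2"] that
    by (subst poly_eq_sum_lessThan[of _ k]) (auto simp: power_mult lessThan_atLeast0)
  have T1B: "T1 * B = 1\<^sub>m k"
  proof (rule eq_matI)
    fix l i assume "l < dim_row (1\<^sub>m k :: real mat)" "i < dim_col (1\<^sub>m k :: real mat)"
    then have li: "l < k" "i < k" by auto
    have "(T1 * B) $$ (l, i) = poly (?p i) ((\<sigma> (Suc l))\<^sup>2)"
      using li eval[OF li(2)] by (simp add: T1_def B_def scalar_prod_def)
    also have "\<dots> = (if Suc i = Suc l then 1 else 0)"
      using li inj by (intro poly_lagrange_basis_node) auto
    finally show "(T1 * B) $$ (l, i) = 1\<^sub>m k $$ (l, i)" using li by simp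
  qed (use c in auto)
  have BT1: "B * T1 = 1\<^sub>m k" by (rule mat_mult_left_right_inverse[OF c(4,6) T1B])
  have D1D1': "D1 * D1' = 1\<^sub>m k" "D1' * D1 = 1\<^sub>m k"
    unfolding D1_def D1'_def mat_diag_diag using nonzero
    by (auto simp: mat_diag_def intro!: eq_matI)
  have splitD: "split_block (D_mat n \<sigma> \<gamma>) k k = (D1, 0\<^sub>m k (n - k), 0\<^sub>m (n - k) k, D2)"
    using kn by (auto simp: split_block_def Let_def D_mat_def D1_def D2_def mat_diag_def intro!: eq_matI)
  have splitT: "split_block (T_mat n k \<sigma>) k k = (T1, mat k 0 (\<lambda>_. 0), T2, mat (n - k) 0 (\<lambda>_. 0))"
    using kn by (auto simp: split_block_def Let_def T_mat_def T1_def T2_def intro!: eq_matI)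
  have Delta: "Delta_mat n k \<sigma> \<gamma> = D2 * T2 * B * D1'"
    using the_mat_inverse_eq[OF c(4,6) T1B] the_mat_inverse_eq[OF c(1,2) D1D1'(1)]
    by (simp add: Delta_mat_def splitD splitT)
  have T2B: "T2 * B = mat (n - k) k (\<lambda>(r, i). poly (?p i) ((\<sigma> (Suc (r + k)))\<^sup>2))"
    using eval by (intro eq_matI) (auto simp: T2_def B_def scalar_prod_def)
  have "D2 * T2 * B = D2 * (T2 * B)" using c by (simp add: assoc_mult_mat_dim)
  also have "\<dots> = mat (n - k) k (\<lambda>(r, i). \<sigma> (Suc (r + k)) * \<gamma> (Suc (r + k)) *
      poly (?p i) ((\<sigma> (Suc (r + k)))\<^sup>2))"
    unfolding T2B D2_def by (subst mat_diag_mult_left[of _ _ k]) (auto intro!: eq_matI)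
  finally show "Delta_mat n k \<sigma> \<gamma> = mat (n - k) k (\<lambda>(r, i).
      \<sigma> (Suc (r + k)) * \<gamma> (Suc (r + k)) * poly (?p i) ((\<sigma> (Suc (r + k)))\<^sup>2) /
      (\<sigma> (Suc i) * \<gamma> (Suc i)))"
    unfolding Delta D1'_def by (simp, subst mat_diag_mult_right[of _ "n - k"]) (auto intro!: eq_matI)
  define G where "G = D1 * T1"
  have G: "G \<in> carrier_mat k k" using c by (simp add: G_def)
  have "G * (B * D1') = D1 * (T1 * B) * D1'"
    using c by (simp add: G_def assoc_mult_mat_dim)
  then have GH: "G * (B * D1') = 1\<^sub>m k" unfolding T1B using c D1D1' by simp
  have Dc: "Delta_mat n k \<sigma> \<gamma> \<in> carrier_mat (n - k) k" unfolding Delta using c by auto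
  have "Delta_mat n k \<sigma> \<gamma> * G = D2 * T2 * B * (D1' * D1) * T1"
    unfolding Delta G_def using c by (simp add: assoc_mult_mat_dim)
  also have "\<dots> = D2 * T2 * (B * T1)"
    unfolding D1D1' using c by (simp add: assoc_mult_mat_dim)
  finally have DG: "Delta_mat n k \<sigma> \<gamma> * G = D2 * T2" unfolding BT1 using c by simp
  have "D_mat n \<sigma> \<gamma> * T_mat n k \<sigma> = G @\<^sub>r (D2 * T2)"
  proof (rule eq_matI)
    fix i j assume "i < dim_row (G @\<^sub>r (D2 * T2))" "j < dim_col (G @\<^sub>r (D2 * T2))"
    then have ij: "i < n" "j < k" using kn c by (auto simp: append_rows_def G_def)
    have "(D_mat n \<sigma> \<gamma> * T_mat n k \<sigma>) $$ (i, j) = \<sigma> (Suc i) * \<gamma> (Suc i) * \<sigma> (Suc i) ^ (2 * j)"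
      unfolding D_mat_def T_mat_def using ij by (subst mat_diag_mult_left[of _ _ k]) auto
    also have "\<dots> = (G @\<^sub>r (D2 * T2)) $$ (i, j)"
      unfolding G_def D1_def D2_def T1_def T2_def using ij kn
      by (subst append_rows_index[of _ k k _ "n - k"])
        (auto simp: mat_diag_mult_left[of _ k k] mat_diag_mult_left[of _ "n - k" k])
    finally show "(D_mat n \<sigma> \<gamma> * T_mat n k \<sigma>) $$ (i, j) = (G @\<^sub>r (D2 * T2)) $$ (i, j)" .
  qed (use kn c in \<open>auto simp: append_rows_def G_def D_mat_def T_mat_def\<close>)
  also have "\<dots> = (1\<^sub>m k @\<^sub>r Delta_mat n k \<sigma> \<gamma>) * G"
    using append_rows_mult[OF one_carrier_mat Dc G] G DG by simp
  finally show "\<exists>G \<in> carrier_mat k k. \<exists>H \<in> carrier_mat k k. G * H = 1\<^sub>m k \<and>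
      D_mat n \<sigma> \<gamma> * T_mat n k \<sigma> = (1\<^sub>m k @\<^sub>r Delta_mat n k \<sigma> \<gamma>) * G"
    using G GH c by (intro bexI[of _ G] bexI[of _ "B * D1'"]) auto
qed

lemma Delta_mat_carrier: "Delta_mat n k \<sigma> \<gamma> \<in> carrier_mat (n - k) k"
  by (simp add: Delta_mat_eq)

end

section \<open>Krylov spaces in singular vector coordinates\<close>

lemma set_cols_mult:
  fixes V F :: "'a :: semiring_0 mat"
  assumes "V \<in> carrier_mat n l" "F \<in> carrier_mat l k"
  shows "set (cols (V * F)) = (\<lambda>j. V *\<^sub>v col F j) ` {..<k}"
proof -
  have "set (cols (V * F)) = (\<lambda>j. col (V * F) j) ` {..<k}"
    using assms by (auto simp: cols_def)
  also have "\<dots> = (\<lambda>j. V *\<^sub>v col F j) ` {..<k}"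
    using assms by (intro image_cong) (auto intro!: col_mult2)
  finally show ?thesis .
qed

context
  fixes m n :: nat and A U V :: "real mat" and \<sigma> :: "nat \<Rightarrow> real"
  assumes svd: "is_svd m n A U (vec n (\<lambda>i. \<sigma> (Suc i))) V"
begin

abbreviation (input) "Sm \<equiv> mat_diag n (\<lambda>i. \<sigma> (Suc i))"
abbreviation (input) "Sr \<equiv> Sm @\<^sub>r 0\<^sub>m (m - n) n"

lemma svd_facts:
  shows "n \<le> m" "U \<in> carrier_mat m m" "U\<^sup>T * U = 1\<^sub>m m" "V \<in> carrier_mat n n" "V\<^sup>T * V = 1\<^sub>m n"
    "Sr \<in> carrier_mat m n" "A = U * Sr * V\<^sup>T"
proof -
  have "mat_diag n (\<lambda>i. vec n (\<lambda>i. \<sigma> (Suc i)) $ i) = Sm"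
    by (intro eq_matI) (auto simp: mat_diag_def)
  then show "A = U * Sr * V\<^sup>T" using svd by (simp add: is_svd_def)
  show "n \<le> m" using svd by (simp add: is_svd_def)
  then show "Sr \<in> carrier_mat m n"
    using carrier_append_rows[OF mat_diag_dim zero_carrier_mat, of n "\<lambda>i. \<sigma> (Suc i)" "m - n"] by simp
qed (use svd in \<open>auto simp: is_svd_def orthonormal_cols_def\<close>)

lemma svd_gram: "A\<^sup>T * A = V * mat_diag n (\<lambda>i. (\<sigma> (Suc i))\<^sup>2) * V\<^sup>T"
proof -
  note d = svd_facts(2,4,6)[THEN carrier_matD(1)] svd_facts(2,4,6)[THEN carrier_matD(2)]
  have "A\<^sup>T * A = V * (Sr\<^sup>T * (U\<^sup>T * U) * Sr) * V\<^sup>T"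
    unfolding svd_facts(7) using d by (simp add: transpose_mult_dim assoc_mult_mat_dim)
  also have "Sr\<^sup>T * (U\<^sup>T * U) * Sr = Sr\<^sup>T * Sr"
    unfolding svd_facts(3) using svd_facts(6) by simp
  also have "\<dots> = Sm\<^sup>T * Sm + (0\<^sub>m (m - n) n)\<^sup>T * 0\<^sub>m (m - n) n"
    by (rule append_rows_transpose_mult) auto
  also have "\<dots> = mat_diag n (\<lambda>i. (\<sigma> (Suc i))\<^sup>2)"
    by (simp add: power2_eq_square)
  finally show ?thesis .
qed

lemma svd_transpose_mult_vec:
  assumes b: "b \<in> carrier_vec m"
  shows "A\<^sup>T *\<^sub>v b = V *\<^sub>v vec n (\<lambda>i. \<sigma> (Suc i) * (col U i \<bullet> b))"
proof -
  note d = svd_facts(2,4,6)[THEN carrier_matD(1)] svd_facts(2,4,6)[THEN carrier_matD(2)]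
  have UTb: "U\<^sup>T *\<^sub>v b \<in> carrier_vec m" using svd_facts(2) b by auto
  have AT: "A\<^sup>T = V * (Sr\<^sup>T * U\<^sup>T)"
    unfolding svd_facts(7) using d by (simp add: transpose_mult_dim assoc_mult_mat_dim)
  have "A\<^sup>T *\<^sub>v b = V *\<^sub>v (Sr\<^sup>T * U\<^sup>T *\<^sub>v b)"
    unfolding AT using svd_facts(2,4,6) b by (intro assoc_mult_mat_vec[of _ n n _ m]) auto
  also have "Sr\<^sup>T * U\<^sup>T *\<^sub>v b = Sr\<^sup>T *\<^sub>v (U\<^sup>T *\<^sub>v b)"
    using svd_facts(2,4,6) b by (intro assoc_mult_mat_vec[of _ n m _ m]) auto
  also have "\<dots> = vec n (\<lambda>i. \<sigma> (Suc i) * (col U i \<bullet> b))"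
  proof (rule eq_vecI)
    fix i assume "i < dim_vec (vec n (\<lambda>i. \<sigma> (Suc i) * (col U i \<bullet> b)))"
    then have i: "i < n" "i < m" using svd_facts(1) by auto
    have col: "col Sr i = \<sigma> (Suc i) \<cdot>\<^sub>v unit_vec m i"
    proof (rule eq_vecI)
      fix r assume "r < dim_vec (\<sigma> (Suc i) \<cdot>\<^sub>v unit_vec m i :: real vec)"
      then have r: "r < m" by simp
      then have "col Sr i $ r = Sr $$ (r, i)" using i d by simp
      also have "\<dots> = (\<sigma> (Suc i) \<cdot>\<^sub>v unit_vec m i) $ r"
        using r i by (subst append_rows_index[of _ n n _ "m - n"]) (auto simp: mat_diag_def)
      finally show "col Sr i $ r = (\<sigma> (Suc i) \<cdot>\<^sub>v unit_vec m i) $ r" .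
    qed (use d in auto)
    have "(Sr\<^sup>T *\<^sub>v (U\<^sup>T *\<^sub>v b)) $ i = col Sr i \<bullet> (U\<^sup>T *\<^sub>v b)"
      using i d by simp
    also have "\<dots> = \<sigma> (Suc i) * (U\<^sup>T *\<^sub>v b) $ i"
      unfolding col using i d scalar_prod_left_unit[OF UTb i(2)] by simp
    also have "\<dots> = \<sigma> (Suc i) * (col U i \<bullet> b)" using i d by simp
    finally show "(Sr\<^sup>T *\<^sub>v (U\<^sup>T *\<^sub>v b)) $ i = vec n (\<lambda>i. \<sigma> (Suc i) * (col U i \<bullet> b)) $ i"
      using i by simp
  qed (use d in auto)
  finally show ?thesis .
qed

lemma svd_gram_pow_mult_vec:
  assumes "w \<in> carrier_vec n"
  shows "((A\<^sup>T * A) ^\<^sub>m j) *\<^sub>v (V *\<^sub>v w) = V *\<^sub>v vec n (\<lambda>i. \<sigma> (Suc i) ^ (2 * j) * w $ i)"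
  using assms
proof (induction j arbitrary: w)
  case 0
  have "vec n (\<lambda>i. w $ i) = w" using 0 by (intro eq_vecI) auto
  then show ?case using 0 svd_facts(4) svd_gram by simp
next
  case (Suc j)
  let ?M = "A\<^sup>T * A" and ?w = "vec n (\<lambda>i. (\<sigma> (Suc i))\<^sup>2 * w $ i)"
  note V = svd_facts(4)
  have M: "?M \<in> carrier_mat n n" unfolding svd_gram using V by auto
  have "?M *\<^sub>v (V *\<^sub>v w) = (?M * V) *\<^sub>v w" using M V Suc.prems by simp
  also have "?M * V = V * mat_diag n (\<lambda>i. (\<sigma> (Suc i))\<^sup>2) * (V\<^sup>T * V)"
    unfolding svd_gram using carrier_matD[OF V] by (simp add: assoc_mult_mat_dim)
  also have "\<dots> = V * mat_diag n (\<lambda>i. (\<sigma> (Suc i))\<^sup>2)"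
    unfolding svd_facts(5) using V by simp
  also have "\<dots> *\<^sub>v w = V *\<^sub>v (mat_diag n (\<lambda>i. (\<sigma> (Suc i))\<^sup>2) *\<^sub>v w)"
    using V Suc.prems by (intro assoc_mult_mat_vec[of _ n n]) auto
  also have "\<dots> = V *\<^sub>v ?w"
    using Suc.prems by (simp add: mat_diag_mult_vec)
  finally have step: "?M *\<^sub>v (V *\<^sub>v w) = V *\<^sub>v ?w" .
  have "(?M ^\<^sub>m Suc j) *\<^sub>v (V *\<^sub>v w) = (?M ^\<^sub>m j) *\<^sub>v (?M *\<^sub>v (V *\<^sub>v w))"
    using M V Suc.prems pow_carrier_mat[OF M, of j]
    by (simp del: assoc_mult_mat_vec add: assoc_mult_mat_vec[of _ n n _ n])
  also have "\<dots> = V *\<^sub>v vec n (\<lambda>i. \<sigma> (Suc i) ^ (2 * j) * ?w $ i)"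
    unfolding step by (rule Suc.IH) simp
  also have "vec n (\<lambda>i. \<sigma> (Suc i) ^ (2 * j) * ?w $ i) = vec n (\<lambda>i. \<sigma> (Suc i) ^ (2 * Suc j) * w $ i)"
    by (intro eq_vecI) (auto simp: power_add power2_eq_square)
  finally show ?case .
qed

text \<open>
In the coordinates given by \<open>V\<close>, the vector \<open>(A\<^sup>T A)\<^sup>j A\<^sup>T b\<close> has the components
\<open>\<sigma>\<^sub>i\<^bsup>2j\<^esup> \<cdot> \<sigma>\<^sub>i u\<^sub>i\<^sup>T b\<close>, that is, it is the corresponding column of \<open>D T\<^sub>k\<close>.
\<close>

lemma krylov_eq_vspan_cols:
  assumes b: "b \<in> carrier_vec m"
  shows "krylov n k (A\<^sup>T * A) (A\<^sup>T *\<^sub>v b) =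
    vspan n (set (cols (V * (D_mat n \<sigma> (\<lambda>i. sing_vec U i \<bullet> b) * T_mat n k \<sigma>))))"
proof -
  let ?DT = "D_mat n \<sigma> (\<lambda>i. sing_vec U i \<bullet> b) * T_mat n k \<sigma>"
  have DT: "?DT \<in> carrier_mat n k" by (auto simp: D_mat_def T_mat_def)
  have "((A\<^sup>T * A) ^\<^sub>m j) *\<^sub>v (A\<^sup>T *\<^sub>v b) = V *\<^sub>v col ?DT j" if j: "j < k" for j
  proof -
    have "col ?DT j = vec n (\<lambda>i. \<sigma> (Suc i) ^ (2 * j) * (\<sigma> (Suc i) * (col U i \<bullet> b)))"
      using j DT unfolding D_mat_def T_mat_def
      by (intro eq_vecI) (auto simp: mat_diag_mult_left[of _ n k] mult_ac)
    also have "\<dots> = vec n (\<lambda>i. \<sigma> (Suc i) ^ (2 * j) * vec n (\<lambda>i. \<sigma> (Suc i) * (col U i \<bullet> b)) $ i)"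
      by (intro eq_vecI) auto
    finally show ?thesis
      unfolding svd_transpose_mult_vec[OF b] by (subst svd_gram_pow_mult_vec) auto
  qed
  then show ?thesis
    unfolding krylov_def set_cols_mult[OF svd_facts(4) DT] by (intro arg_cong[of _ _ "vspan n"] image_cong) auto
qed

lemma vspan_sing_vecs:
  assumes "k \<le> n"
  shows "vspan n (sing_vec V ` {1..k}) = vspan n (set (cols (V * (1\<^sub>m k @\<^sub>r 0\<^sub>m (n - k) k))))"
proof -
  let ?E = "1\<^sub>m k @\<^sub>r 0\<^sub>m (n - k) k :: real mat"
  have E: "?E \<in> carrier_mat n k"
    using carrier_append_rows[OF one_carrier_mat zero_carrier_mat, of k "n - k"] assms by simp
  have "V *\<^sub>v col ?E j = col V j" if j: "j < k" for j
  proof -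
    have "col ?E j = unit_vec n j"
    proof (rule eq_vecI)
      fix r assume "r < dim_vec (unit_vec n j :: real vec)"
      then have r: "r < n" by simp
      then have "col ?E j $ r = ?E $$ (r, j)" using j carrier_matD[OF E] by simp
      also have "\<dots> = unit_vec n j $ r"
        using r j assms by (subst append_rows_index[of _ k k _ "n - k"]) auto
      finally show "col ?E j $ r = unit_vec n j $ r" .
    qed (use carrier_matD[OF E] in simp)
    then show ?thesis using j assms svd_facts(4) by (intro eq_vecI) auto
  qed
  then have "set (cols (V * ?E)) = (\<lambda>j. col V j) ` {..<k}"
    unfolding set_cols_mult[OF svd_facts(4) E] by (intro image_cong) auto
  also have "\<dots> = sing_vec V ` {1..k}"
  proof -
    have "{1..k} = Suc ` {..<k}" by (simp add: image_Suc_lessThan)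
    then show ?thesis by (simp add: image_image)
  qed
  finally show ?thesis by simp
qed

text \<open>
Applying an orthogonal matrix does not change Gram matrices. The singular subspace and the Krylov space
are the images under \<open>V\<close> of the coordinate subspace and of the graph of \<open>\<Delta>\<^sub>k\<close> over it, respectively.
\<close>

theorem norm_sin_tan_krylov_angles:
  fixes b :: "real vec" and k :: nat
  defines "\<gamma> \<equiv> \<lambda>i. sing_vec U i \<bullet> b"
  defines "VX \<equiv> vspan n (sing_vec V ` {1..k})" and "VZ \<equiv> krylov n k (A\<^sup>T * A) (A\<^sup>T *\<^sub>v b)"
  assumes b: "b \<in> carrier_vec m" and k: "0 < k" "k \<le> n"
    and inj: "inj_on (\<lambda>i. (\<sigma> i)\<^sup>2) {1..k}" and nonzero: "\<And>i. i \<in> {1..k} \<Longrightarrow> \<sigma> i * \<gamma> i \<noteq> 0"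
  shows "mat_norm2 (fun_Theta tan n k VX VZ) = mat_norm2 (Delta_mat n k \<sigma> \<gamma>)"
    and "mat_norm2 (fun_Theta sin n k VX VZ) =
      mat_norm2 (Delta_mat n k \<sigma> \<gamma>) / sqrt (1 + (mat_norm2 (Delta_mat n k \<sigma> \<gamma>))\<^sup>2)"
proof -
  define D where "D = Delta_mat n k \<sigma> \<gamma>"
  define N where "N = (0\<^sub>m (n - k) k :: real mat)"
  have D: "D \<in> carrier_mat (n - k) k"
    unfolding D_def by (rule Delta_mat_carrier[OF k(2) inj nonzero])
  have N: "N \<in> carrier_mat (n - k) k" by (simp add: N_def)
  define E where "E = 1\<^sub>m k @\<^sub>r N"
  define F where "F = 1\<^sub>m k @\<^sub>r D"
  have E: "E \<in> carrier_mat n k" and F: "F \<in> carrier_mat n k"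
    using carrier_append_rows[OF one_carrier_mat N] carrier_append_rows[OF one_carrier_mat D] k
    by (auto simp: E_def F_def)
  note V = svd_facts(4,5)
  have gram: "(V * G)\<^sup>T * (V * H) = G\<^sup>T * H" if "G \<in> carrier_mat n k" "H \<in> carrier_mat n k" for G H
  proof -
    have "(V * G)\<^sup>T * (V * H) = G\<^sup>T * (V\<^sup>T * V) * H"
      using that V(1) by (simp add: transpose_mult_dim assoc_mult_mat_dim)
    then show ?thesis unfolding V(2) using that by simp
  qed
  have EE: "E\<^sup>T * E = 1\<^sub>m k" and EF: "E\<^sup>T * F = 1\<^sub>m k" and FF: "F\<^sup>T * F = 1\<^sub>m k + D\<^sup>T * D"
    using append_rows_transpose_mult[OF one_carrier_mat N one_carrier_mat N]
      append_rows_transpose_mult[OF one_carrier_mat N one_carrier_mat D]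
      append_rows_transpose_mult[OF one_carrier_mat D one_carrier_mat D] D
    by (simp_all add: E_def F_def) (simp_all add: N_def)
  have VX: "VX = vspan n (set (cols (V * E)))"
    unfolding VX_def E_def N_def by (rule vspan_sing_vecs[OF k(2)])
  obtain G H where GH: "G \<in> carrier_mat k k" "H \<in> carrier_mat k k" "G * H = 1\<^sub>m k"
    and DT: "D_mat n \<sigma> \<gamma> * T_mat n k \<sigma> = F * G"
    using D_T_factorization[OF k(2) inj nonzero] unfolding F_def D_def by blast
  have "V * (F * G) = V * F * G" using V F GH by simp
  then have VZ: "VZ = vspan n (set (cols (V * F)))"
    unfolding VZ_def krylov_eq_vspan_cols[OF b] \<gamma>_def[symmetric] DT
    using vspan_cols_mult_invertible[OF _ GH, of "V * F" n] V F by simp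
  note * = norm_sin_tan_canonical_angles_of_graph[of "V * E" n k "V * F" D "n - k"]
  show "mat_norm2 (fun_Theta tan n k VX VZ) = mat_norm2 (Delta_mat n k \<sigma> \<gamma>)"
    unfolding VX VZ D_def[symmetric]
    by (rule *(1)) (use V E F D EE EF FF gram k in auto)
  show "mat_norm2 (fun_Theta sin n k VX VZ) =
      mat_norm2 (Delta_mat n k \<sigma> \<gamma>) / sqrt (1 + (mat_norm2 (Delta_mat n k \<sigma> \<gamma>))\<^sup>2)"
    unfolding VX VZ D_def[symmetric]
    by (rule *(2)) (use V E F D EE EF FF gram k in auto)
qed

end

section \<open>Estimates from geometric decay\<close>

text \<open>
For \<open>M = 1\<close>, the squares after the leading one are dominated by \<open>C\<^sup>2\<close> times a geometric series with
ratio \<open>1 / \<rho>\<^sup>2\<close>. Their sum is at most \<open>2 C\<^sup>2 / \<rho>\<^sup>2\<close> whatever the number of terms, which is where the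
uniformity in the dimensions comes from.
\<close>

lemma L2_set_geometric_bound:
  fixes f :: "nat \<Rightarrow> real"
  assumes f: "\<And>r. r < N \<Longrightarrow> 0 \<le> f r" "\<And>r. r < N \<Longrightarrow> f r \<le> M * (if r = 0 then 1 else C / \<rho> ^ r)"
    and M: "0 \<le> M" and \<rho>: "2 \<le> \<rho>"
  shows "L2_set f {0..<N} \<le> M * sqrt (1 + 2 * C\<^sup>2 / \<rho>\<^sup>2)"
proof -
  define t where "t = 1 / \<rho>\<^sup>2"
  have "2\<^sup>2 \<le> \<rho>\<^sup>2" using \<rho> by (intro power_mono) auto
  then have "0 < \<rho>\<^sup>2" "2 \<le> \<rho>\<^sup>2" using \<rho> by simp_all
  then have t: "0 < t" "t \<le> 1 / 2" by (simp_all add: t_def field_simps)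
  let ?a = "\<lambda>r. if r = 0 then 1 else C / \<rho> ^ r"
  have geo: "(\<Sum>r<n. t ^ r) \<le> 2" for n
  proof -
    have "(\<Sum>r<n. t ^ r) \<le> (\<Sum>r. t ^ r)" using t by (intro sum_le_suminf summable_geometric) auto
    also have "\<dots> = 1 / (1 - t)" using t by (intro suminf_geometric) auto
    also have "\<dots> \<le> 2" using t by (simp add: field_simps)
    finally show ?thesis .
  qed
  have "(\<Sum>r\<in>{0..<N}. (?a r)\<^sup>2) \<le> 1 + 2 * C\<^sup>2 * t"
  proof (cases N)
    case 0
    then show ?thesis using t by simp
  next
    case (Suc n)
    have "(\<Sum>r\<in>{0..<N}. (?a r)\<^sup>2) = 1 + (\<Sum>r<n. (C / \<rho> ^ Suc r)\<^sup>2)"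
      unfolding Suc lessThan_atLeast0[symmetric] by (subst sum.lessThan_Suc_shift) simp
    also have "(\<Sum>r<n. (C / \<rho> ^ Suc r)\<^sup>2) = C\<^sup>2 * t * (\<Sum>r<n. t ^ r)"
      unfolding sum_distrib_left
      by (intro sum.cong refl) (simp add: t_def power_divide power_mult_distrib power_mult[symmetric] mult.commute)
    also have "\<dots> \<le> C\<^sup>2 * t * 2" using geo t by (intro mult_left_mono) auto
    finally show ?thesis by simp
  qed
  then have a: "L2_set ?a {0..<N} \<le> sqrt (1 + 2 * C\<^sup>2 / \<rho>\<^sup>2)"
    by (simp add: L2_set_def t_def)
  have "L2_set f {0..<N} \<le> L2_set (\<lambda>r. M * ?a r) {0..<N}"
    using f by (intro L2_set_mono) auto
  also have "\<dots> = M * L2_set ?a {0..<N}" using M by (simp only: L2_set_right_distrib)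
  also have "\<dots> \<le> M * sqrt (1 + 2 * C\<^sup>2 / \<rho>\<^sup>2)" using a M by (rule mult_left_mono)
  finally show ?thesis .
qed

text \<open>
For \<open>y\<close> between 0 and all nodes, each factor \<open>\<bar>y - x\<^sub>l\<bar>\<close> is largest at \<open>y = 0\<close>; the right-hand side is the absolute
value of the basis polynomial there.
\<close>

lemma abs_lagrange_basis_le_at_zero:
  assumes x: "\<And>l. l \<in> I \<Longrightarrow> y \<le> x l" and y: "0 \<le> y"
  shows "\<bar>poly (lagrange_basis I x i) y\<bar> \<le> (\<Prod>l\<in>I - {i}. x l / \<bar>x i - x l\<bar>)"
  unfolding poly_lagrange_basis abs_prod
proof (intro prod_mono conjI)
  fix l assume "l \<in> I - {i}"
  then have "\<bar>y - x l\<bar> \<le> x l" using x y by force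
  then show "\<bar>(y - x l) / (x i - x l)\<bar> \<le> x l / \<bar>x i - x l\<bar>"
    by (simp add: abs_divide divide_right_mono)
qed simp

context
  fixes n :: nat and \<sigma> :: "nat \<Rightarrow> real"
  assumes pos: "\<And>i. i \<in> {1..n} \<Longrightarrow> 0 < \<sigma> i"
    and dec: "\<And>i. i \<in> {1..<n} \<Longrightarrow> \<sigma> (i + 1) < \<sigma> i"
begin

lemma sigma_strict_decreasing:
  assumes "1 \<le> i" "i < j" "j \<le> n"
  shows "\<sigma> j < \<sigma> i"
  using assms(2,3)
proof (induction j)
  case (Suc j)
  have "\<sigma> (Suc j) < \<sigma> j" using dec[of j] Suc.prems assms(1) by simp
  then show ?case using Suc by (cases "i = j") auto
qed simp

lemma inj_on_sigma_squared: "inj_on (\<lambda>i. (\<sigma> i)\<^sup>2) {1..n}"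
proof (rule inj_onI)
  fix i j assume ij: "i \<in> {1..n}" "j \<in> {1..n}" "(\<sigma> i)\<^sup>2 = (\<sigma> j)\<^sup>2"
  then have "\<sigma> i = \<sigma> j" using pos[of i] pos[of j] by (simp add: power2_eq_iff)
  then show "i = j" using sigma_strict_decreasing[of i j] sigma_strict_decreasing[of j i] ij
    by (cases i j rule: linorder_cases) auto
qed

context
  fixes \<gamma> :: "nat \<Rightarrow> real"
  assumes nonzero: "\<And>i. i \<in> {1..n} \<Longrightarrow> \<gamma> i \<noteq> 0"
    and decg: "\<And>i. i \<in> {1..<n} \<Longrightarrow> \<bar>\<gamma> (i + 1)\<bar> \<le> \<bar>\<gamma> i\<bar>"
begin

lemma gamma_decreasing:
  assumes "1 \<le> i" "i \<le> j" "j \<le> n"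
  shows "\<bar>\<gamma> j\<bar> \<le> \<bar>\<gamma> i\<bar>"
  using assms(2,3)
proof (induction j)
  case (Suc j)
  then show ?case using decg[of j] assms(1) by (cases "i = Suc j") auto
qed simp

text \<open>
The entry in row \<open>r\<close> and column \<open>i\<close> is at most \<open>f r * g i\<close>, where \<open>f\<close> collects the weights \<open>\<sigma>\<^sub>j \<bar>\<gamma>\<^sub>j\<bar>\<close> with
\<open>j > k\<close>, and \<open>g\<close> the inverse weights with \<open>j \<le> k\<close> times the largest Lagrange factor. The weights decay
geometrically in \<open>j\<close>, so that \<open>f\<close> is dominated by its first term and \<open>g\<close> by its last one. Each of the two
sequences contributes a factor \<open>sqrt (1 + 2 C\<^sup>2 / \<rho>\<^sup>2)\<close>.
\<close>

lemma norm_Delta_mat_le: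
  assumes k: "0 < k" "k < n" and \<rho>: "2 \<le> \<rho>"
    and ratio: "\<And>i j. 1 \<le> i \<Longrightarrow> i \<le> j \<Longrightarrow> j \<le> n \<Longrightarrow> \<sigma> j / \<sigma> i \<le> C / \<rho> ^ (j - i)"
  shows "mat_norm2 (Delta_mat n k \<sigma> \<gamma>) \<le>
    \<sigma> (k + 1) / \<sigma> k * (\<bar>\<gamma> (k + 1)\<bar> / \<bar>\<gamma> k\<bar>) * (1 + 2 * C\<^sup>2 / \<rho>\<^sup>2) * max_abs_L0 k \<sigma>"
proof -
  have inj: "inj_on (\<lambda>i. (\<sigma> i)\<^sup>2) {1..k}"
    by (rule inj_on_subset[OF inj_on_sigma_squared]) (use k in auto)
  have nz: "\<sigma> i * \<gamma> i \<noteq> 0" if "i \<in> {1..k}" for i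
    using pos[of i] nonzero[of i] that k by auto
  have kn: "k \<le> n" using k by simp
  let ?L = "max_abs_L0 k \<sigma>"
  have abs_L0: "abs_L0 k \<sigma> i \<le> ?L" if "i \<in> {1..k}" for i
    unfolding max_abs_L0_def using that by (intro Max_ge) auto
  have "0 \<le> abs_L0 k \<sigma> 1" unfolding abs_L0_def by (intro prod_nonneg) auto
  then have L0: "0 \<le> ?L" using abs_L0[of 1] k by auto
  let ?w = "\<lambda>i. \<sigma> i * \<bar>\<gamma> i\<bar>"
  have w: "0 < ?w i" if "i \<in> {1..n}" for i using pos[OF that] nonzero[OF that] by simp
  have wratio: "?w j \<le> ?w i * (if j - i = 0 then 1 else C / \<rho> ^ (j - i))"
    if ij: "1 \<le> i" "i \<le> j" "j \<le> n" for i j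
  proof (cases "i = j")
    case False
    have "\<sigma> j \<le> \<sigma> i * (C / \<rho> ^ (j - i))"
      using ratio[OF ij] pos[of i] ij by (simp add: pos_divide_le_eq mult.commute)
    moreover have "0 \<le> \<sigma> j" using pos[of j] ij by simp
    ultimately have "?w j \<le> \<sigma> i * (C / \<rho> ^ (j - i)) * \<bar>\<gamma> i\<bar>"
      using gamma_decreasing[OF ij] by (intro mult_mono) auto
    then show ?thesis using False ij by (simp add: mult_ac)
  qed simp
  define f where "f = (\<lambda>r. ?w (Suc (r + k)))"
  define g where "g = (\<lambda>i. ?L / ?w (Suc i))"
  have "mat_norm2 (Delta_mat n k \<sigma> \<gamma>) \<le> L2_set f {0..<n - k} * L2_set g {0..<k}"
  proof (rule mat_norm2_le_of_entries[OF Delta_mat_carrier[OF kn inj nz]])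
    fix r i assume ri: "r < n - k" "i < k"
    let ?p = "poly (lagrange_basis {1..k} (\<lambda>i. (\<sigma> i)\<^sup>2) (Suc i)) ((\<sigma> (Suc (r + k)))\<^sup>2)"
    have "\<bar>?p\<bar> \<le> (\<Prod>l\<in>{1..k} - {Suc i}. (\<sigma> l)\<^sup>2 / \<bar>(\<sigma> (Suc i))\<^sup>2 - (\<sigma> l)\<^sup>2\<bar>)"
    proof (rule abs_lagrange_basis_le_at_zero)
      fix l assume "l \<in> {1..k}"
      then show "(\<sigma> (Suc (r + k)))\<^sup>2 \<le> (\<sigma> l)\<^sup>2"
        using sigma_strict_decreasing[of l "Suc (r + k)"] pos[of "Suc (r + k)"] ri
        by (intro power_mono less_imp_le) auto
    qed simp
    also have "\<dots> = abs_L0 k \<sigma> (Suc i)" by (simp add: abs_L0_def)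
    also have "\<dots> \<le> ?L" using ri by (intro abs_L0) auto
    finally have p: "\<bar>?p\<bar> \<le> ?L" .
    have "\<bar>Delta_mat n k \<sigma> \<gamma> $$ (r, i)\<bar> = \<bar>\<sigma> (Suc (r + k))\<bar> * \<bar>\<gamma> (Suc (r + k))\<bar> * \<bar>?p\<bar> /
        (\<bar>\<sigma> (Suc i)\<bar> * \<bar>\<gamma> (Suc i)\<bar>)"
      using ri by (subst Delta_mat_eq[OF kn inj nz]) (auto simp: abs_mult abs_divide)
    also have "\<dots> = f r * (\<bar>?p\<bar> / ?w (Suc i))"
      using w[of "Suc (r + k)"] w[of "Suc i"] pos[of "Suc (r + k)"] pos[of "Suc i"] ri
      by (simp add: f_def less_diff_conv)
    also have "\<dots> \<le> f r * g i"
      unfolding g_def f_def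
      by (intro mult_left_mono divide_right_mono p less_imp_le[OF w]) (use ri in auto)
    finally show "\<bar>Delta_mat n k \<sigma> \<gamma> $$ (r, i)\<bar> \<le> f r * g i" .
  next
    fix r assume "r < n - k"
    then have "Suc (r + k) \<in> {1..n}" by auto
    from less_imp_le[OF w[OF this]] show "0 \<le> f r" by (simp only: f_def)
  qed
  also have "\<dots> \<le> (?w (k + 1) * sqrt (1 + 2 * C\<^sup>2 / \<rho>\<^sup>2)) * (?L / ?w k * sqrt (1 + 2 * C\<^sup>2 / \<rho>\<^sup>2))"
  proof (rule mult_mono)
    show "L2_set f {0..<n - k} \<le> ?w (k + 1) * sqrt (1 + 2 * C\<^sup>2 / \<rho>\<^sup>2)"
    proof (rule L2_set_geometric_bound[OF _ _ _ \<rho>])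
      fix r assume r: "r < n - k"
      have "Suc (r + k) \<in> {1..n}" using r by auto
      from less_imp_le[OF w[OF this]] show "0 \<le> f r" by (simp only: f_def)
      show "f r \<le> ?w (k + 1) * (if r = 0 then 1 else C / \<rho> ^ r)"
      proof -
        have "?w (Suc (r + k)) \<le> ?w (k + 1) *
            (if Suc (r + k) - (k + 1) = 0 then 1 else C / \<rho> ^ (Suc (r + k) - (k + 1)))"
          by (rule wratio) (use r in auto)
        moreover have "Suc (r + k) - (k + 1) = r" by simp
        ultimately show ?thesis by (simp only: f_def)
      qed
    qed (use w[of "k + 1"] k in auto)
    \<comment> \<open>The dominant term of \<open>g\<close> is the last one, so the order of summation is reversed.\<close>
    have "L2_set g {0..<k} = L2_set (\<lambda>r. g (k - Suc r)) {0..<k}"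
      unfolding L2_set_def lessThan_atLeast0[symmetric]
      using sum.nat_diff_reindex[of "\<lambda>i. (g i)\<^sup>2" k] by simp
    also have "\<dots> \<le> ?L / ?w k * sqrt (1 + 2 * C\<^sup>2 / \<rho>\<^sup>2)"
    proof (rule L2_set_geometric_bound[OF _ _ _ \<rho>])
      fix r assume r: "r < k"
      then have j: "Suc (k - Suc r) = k - r" "k - r \<in> {1..n}" using k by auto
      show "0 \<le> g (k - Suc r)" unfolding g_def j(1) using w[OF j(2)] L0 by simp
      have "?w k \<le> ?w (k - r) * (if k - (k - r) = 0 then 1 else C / \<rho> ^ (k - (k - r)))"
        by (rule wratio) (use r k in auto)
      moreover have "k - (k - r) = r" using r by simp
      ultimately have "?w k \<le> ?w (k - r) * (if r = 0 then 1 else C / \<rho> ^ r)"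
        by (simp only:)
      then have "1 / ?w (k - r) \<le> 1 / ?w k * (if r = 0 then 1 else C / \<rho> ^ r)"
        using w[OF j(2)] w[of k] k by (simp add: field_simps split: if_splits)
      from mult_left_mono[OF this L0]
      show "g (k - Suc r) \<le> ?L / ?w k * (if r = 0 then 1 else C / \<rho> ^ r)"
        unfolding g_def j(1) by simp
    qed (use w[of k] k L0 in auto)
    finally show "L2_set g {0..<k} \<le> ?L / ?w k * sqrt (1 + 2 * C\<^sup>2 / \<rho>\<^sup>2)" .
  qed (use w[of "k + 1"] k in auto)
  also have "\<dots> = \<sigma> (k + 1) / \<sigma> k * (\<bar>\<gamma> (k + 1)\<bar> / \<bar>\<gamma> k\<bar>) *
      (sqrt (1 + 2 * C\<^sup>2 / \<rho>\<^sup>2) * sqrt (1 + 2 * C\<^sup>2 / \<rho>\<^sup>2)) * ?L"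
    by simp
  also have "sqrt (1 + 2 * C\<^sup>2 / \<rho>\<^sup>2) * sqrt (1 + 2 * C\<^sup>2 / \<rho>\<^sup>2) = 1 + 2 * C\<^sup>2 / \<rho>\<^sup>2"
    by (intro real_sqrt_mult_self[THEN trans]) simp
  finally show ?thesis .
qed

end

end

section \<open>Angles between singular subspaces and Krylov spaces of severely ill-posed problems\<close>

text \<open>
The constants are \<open>K = 2 C\<^sup>2\<close> and \<open>\<rho>0 = 2\<close>. The special bounds differ from the general one only by the
value of the ratio \<open>\<bar>\<gamma> (k + 1)\<bar> / \<bar>\<gamma> k\<bar>\<close> on either side of the transition index, and by \<open>L = 1\<close> for \<open>k = 1\<close>.
\<close>

theorem theorem1:
  fixes c C \<beta> :: real
  assumes "0 < c" and "c \<le> C" and "0 < \<beta>"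
  shows "\<exists>K \<rho>0 :: real.
    \<forall>(m :: nat) (n :: nat) (A :: real mat) (U :: real mat) (V :: real mat) (\<sigma> :: nat \<Rightarrow> real)
      (\<rho> :: real) (b :: real vec) (bh :: real vec) (e :: real vec) (\<eta> :: real) (k0 :: nat) (k :: nat).
      n \<le> m \<longrightarrow> A \<in> carrier_mat m n \<longrightarrow> b \<in> carrier_vec m \<longrightarrow>
      is_svd m n A U (vec n (\<lambda>i. \<sigma> (Suc i))) V \<longrightarrow>
      (\<forall>i \<in> {1..<n}. \<sigma> (i + 1) < \<sigma> i) \<longrightarrow> (\<forall>i \<in> {1..n}. 0 < \<sigma> i) \<longrightarrow>
      severely_ill_posed c C \<rho> n \<sigma> \<longrightarrow>
      discrete_picard m n U \<sigma> \<beta> b bh e \<eta> k0 \<longrightarrow>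
      k \<in> {1..n - 1} \<longrightarrow>
      (let \<gamma> = (\<lambda>i. sing_vec U i \<bullet> b);
           Vk = vspan n (sing_vec V ` {1..k});
           VkR = krylov n k (A\<^sup>T * A) (A\<^sup>T *\<^sub>v b);
           \<Delta> = mat_norm2 (Delta_mat n k \<sigma> \<gamma>);
           L = max_abs_L0 k \<sigma>
       in
         mat_norm2 (fun_Theta sin n k Vk VkR) = \<Delta> / sqrt (1 + \<Delta>\<^sup>2) \<and>
         mat_norm2 (fun_Theta tan n k Vk VkR) = \<Delta> \<and>
         (\<rho>0 \<le> \<rho> \<longrightarrow>
           (k = 1 \<longrightarrow>
             (\<exists>r. \<bar>r\<bar> \<le> K / \<rho>\<^sup>2 \<and>
               \<Delta> \<le> \<sigma> 2 / \<sigma> 1 * (\<bar>\<gamma> 2\<bar> / \<bar>\<gamma> 1\<bar>) * (1 + r)) \<and>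
             (\<exists>r. \<bar>r\<bar> \<le> K / \<rho>\<^sup>2 \<and>
               \<Delta> \<le> \<sigma> 2 powr (2 + \<beta>) / \<sigma> 1 powr (2 + \<beta>) * (1 + r))) \<and>
           (2 \<le> k \<longrightarrow>
             (\<exists>r. \<bar>r\<bar> \<le> K / \<rho>\<^sup>2 \<and>
               \<Delta> \<le> \<sigma> (k + 1) / \<sigma> k * (\<bar>\<gamma> (k + 1)\<bar> / \<bar>\<gamma> k\<bar>) * (1 + r) * L)) \<and>
           (2 \<le> k \<and> k \<le> k0 \<longrightarrow>
             (\<exists>r. \<bar>r\<bar> \<le> K / \<rho>\<^sup>2 \<and>
               \<Delta> \<le> \<sigma> (k + 1) powr (2 + \<beta>) / \<sigma> k powr (2 + \<beta>) * (1 + r) * L)) \<and>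
           (k0 < k \<longrightarrow>
             (\<exists>r. \<bar>r\<bar> \<le> K / \<rho>\<^sup>2 \<and>
               \<Delta> \<le> \<sigma> (k + 1) / \<sigma> k * (1 + r) * L))))"
proof -
  have main: "mat_norm2 (fun_Theta sin n k Vk VkR) = \<Delta> / sqrt (1 + \<Delta>\<^sup>2) \<and>
      mat_norm2 (fun_Theta tan n k Vk VkR) = \<Delta> \<and>
      (2 \<le> \<rho> \<longrightarrow>
        \<Delta> \<le> \<sigma> (k + 1) / \<sigma> k * (\<bar>\<gamma> (k + 1)\<bar> / \<bar>\<gamma> k\<bar>) * (1 + r) * L \<and>
        (k \<le> k0 \<longrightarrow> \<Delta> \<le> \<sigma> (k + 1) powr (2 + \<beta>) / \<sigma> k powr (2 + \<beta>) * (1 + r) * L) \<and>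
        (k0 < k \<longrightarrow> \<Delta> \<le> \<sigma> (k + 1) / \<sigma> k * (1 + r) * L)) \<and>
      (2 \<le> \<rho> \<and> k = 1 \<longrightarrow>
        \<Delta> \<le> \<sigma> 2 / \<sigma> 1 * (\<bar>\<gamma> 2\<bar> / \<bar>\<gamma> 1\<bar>) * (1 + r) \<and>
        \<Delta> \<le> \<sigma> 2 powr (2 + \<beta>) / \<sigma> 1 powr (2 + \<beta>) * (1 + r))"
    if b: "b \<in> carrier_vec m" and svd: "is_svd m n A U (vec n (\<lambda>i. \<sigma> (Suc i))) V"
      and dec: "\<forall>i \<in> {1..<n}. \<sigma> (i + 1) < \<sigma> i" and pos: "\<forall>i \<in> {1..n}. 0 < \<sigma> i"
      and sip: "severely_ill_posed c C \<rho> n \<sigma>" and pic: "discrete_picard m n U \<sigma> \<beta> b bh e \<eta> k0"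
      and k: "k \<in> {1..n - 1}"
      and defs: "\<gamma> = (\<lambda>i. sing_vec U i \<bullet> b)" "Vk = vspan n (sing_vec V ` {1..k})"
        "VkR = krylov n k (A\<^sup>T * A) (A\<^sup>T *\<^sub>v b)" "\<Delta> = mat_norm2 (Delta_mat n k \<sigma> \<gamma>)"
        "L = max_abs_L0 k \<sigma>" "r = 2 * C\<^sup>2 / \<rho>\<^sup>2"
    for m n A U V \<sigma> \<rho> b bh e \<eta> k0 k \<gamma> Vk VkR \<Delta> L r
  proof -
    have k': "0 < k" "k < n" using k by auto
    have pic': "0 < \<eta>" "1 \<le> k0" "\<And>j. j \<in> {1..k0} \<Longrightarrow> \<bar>\<gamma> j\<bar> = \<sigma> j powr (1 + \<beta>)"
      "\<And>j. j \<in> {k0<..n} \<Longrightarrow> \<bar>\<gamma> j\<bar> = \<eta>" "k0 < n"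
      "\<And>j. j \<in> {1..<n} \<Longrightarrow> \<bar>\<gamma> (j + 1)\<bar> \<le> \<bar>\<gamma> j\<bar>"
      "\<And>j. j \<in> {1..k0} \<Longrightarrow> \<bar>\<gamma> (j + 1)\<bar> / \<bar>\<gamma> j\<bar> = (\<sigma> (j + 1) / \<sigma> j) powr (1 + \<beta>)"
      "\<And>j. j \<in> {k0<..<n} \<Longrightarrow> \<bar>\<gamma> (j + 1)\<bar> / \<bar>\<gamma> j\<bar> = 1"
      using pic unfolding discrete_picard_def defs(1) by blast+
    have nonzero: "\<gamma> i \<noteq> 0" if "i \<in> {1..n}" for i
    proof (cases "i \<le> k0")
      case True
      have "0 < \<sigma> i" using pos that by blast
      then show ?thesis using pic'(3)[of i] True that by auto
    next
      case False
      then show ?thesis using pic'(1) pic'(4)[of i] that by auto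
    qed
    have pos': "\<And>i. i \<in> {1..n} \<Longrightarrow> 0 < \<sigma> i" and dec': "\<And>i. i \<in> {1..<n} \<Longrightarrow> \<sigma> (i + 1) < \<sigma> i"
      using pos dec by blast+
    have inj: "inj_on (\<lambda>i. (\<sigma> i)\<^sup>2) {1..k}"
      by (rule inj_on_subset[OF inj_on_sigma_squared[of n \<sigma>]]) (use pos' dec' k' in auto)
    have nz: "\<sigma> i * (sing_vec U i \<bullet> b) \<noteq> 0" if "i \<in> {1..k}" for i
      using pos'[of i] nonzero[of i] that k' unfolding defs(1) by auto
    have "k \<le> n" using k' by simp
    note angles = norm_sin_tan_krylov_angles[OF svd b k'(1) this inj nz, folded defs(1), folded defs(2-4)]
    have ratio: "\<sigma> j / \<sigma> i \<le> C / \<rho> ^ (j - i)" if "1 \<le> i" "i \<le> j" "j \<le> n" for i j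
      using sip that unfolding severely_ill_posed_def by blast
    have bound: "\<Delta> \<le> \<sigma> (k + 1) / \<sigma> k * (\<bar>\<gamma> (k + 1)\<bar> / \<bar>\<gamma> k\<bar>) * (1 + r) * L" if "2 \<le> \<rho>"
      unfolding defs(4-6) by (rule norm_Delta_mat_le[where \<sigma> = \<sigma> and \<gamma> = \<gamma>, OF pos' dec' nonzero pic'(6) k' that ratio])
    have early: "\<sigma> (k + 1) / \<sigma> k * (\<bar>\<gamma> (k + 1)\<bar> / \<bar>\<gamma> k\<bar>) = \<sigma> (k + 1) powr (2 + \<beta>) / \<sigma> k powr (2 + \<beta>)"
      if "k \<le> k0"
    proof -
      have s: "0 < \<sigma> k" "0 < \<sigma> (k + 1)" using pos'[of k] pos'[of "k + 1"] k' by auto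
      have "\<sigma> (k + 1) / \<sigma> k * (\<bar>\<gamma> (k + 1)\<bar> / \<bar>\<gamma> k\<bar>) = (\<sigma> (k + 1) / \<sigma> k) powr (1 + (1 + \<beta>))"
        using pic'(7)[of k] that k' s powr_mult_base[of "\<sigma> (k + 1) / \<sigma> k" "1 + \<beta>"] by simp
      also have "\<dots> = \<sigma> (k + 1) powr (2 + \<beta>) / \<sigma> k powr (2 + \<beta>)"
        using s by (simp add: powr_divide)
      finally show ?thesis .
    qed
    have late: "\<bar>\<gamma> (k + 1)\<bar> / \<bar>\<gamma> k\<bar> = 1" if "k0 < k"
      by (rule pic'(8)) (use that k' in auto)
    have bound_early: "\<Delta> \<le> \<sigma> (k + 1) powr (2 + \<beta>) / \<sigma> k powr (2 + \<beta>) * (1 + r) * L"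
      if "2 \<le> \<rho>" "k \<le> k0"
      using bound[OF that(1)] unfolding early[OF that(2)] .
    have bound_late: "\<Delta> \<le> \<sigma> (k + 1) / \<sigma> k * (1 + r) * L" if "2 \<le> \<rho>" "k0 < k"
      using bound[OF that(1)] unfolding late[OF that(2)] mult_1_right .
    have L1: "L = 1" if "k = 1"
      using that by (simp add: defs(5) max_abs_L0_def abs_L0_def)
    have bound_one: "\<Delta> \<le> \<sigma> 2 / \<sigma> 1 * (\<bar>\<gamma> 2\<bar> / \<bar>\<gamma> 1\<bar>) * (1 + r)" if "2 \<le> \<rho>" "k = 1"
      using bound[OF that(1)] unfolding L1[OF that(2)] that(2) one_add_one mult_1_right .
    have "k \<le> k0" if "k = 1" using that pic'(2) by simp
    note bound_early_one = bound_early[OF _ this]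
    have bound_one': "\<Delta> \<le> \<sigma> 2 powr (2 + \<beta>) / \<sigma> 1 powr (2 + \<beta>) * (1 + r)" if "2 \<le> \<rho>" "k = 1"
      using bound_early_one[OF that] unfolding L1[OF that(2)] that(2) one_add_one mult_1_right .
    show ?thesis
      using angles bound bound_early bound_late bound_one bound_one' by blast
  qed
  show ?thesis
  proof (rule exI[of _ "2 * C\<^sup>2"], rule exI[of _ 2], intro allI impI, goal_cases)
    case (1 m n A U V \<sigma> \<rho> b bh e \<eta> k0 k)
    note * = main[OF 1(3-9) refl refl refl refl refl refl]
    have r: "\<bar>2 * C\<^sup>2 / \<rho>\<^sup>2\<bar> \<le> 2 * C\<^sup>2 / \<rho>\<^sup>2" by simp
    show ?case unfolding Let_def
      by (intro conjI impI exI[of _ "2 * C\<^sup>2 / \<rho>\<^sup>2"] r) (use * in blast)+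
  qed
qed

end
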